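(* Let $W=W_1\oplus\cdots\oplus W_m$, where each $W_i=w_{i,1}\oplus\cdots\oplus w_{i,k_i}$ is a direct sum of classical scalar weights, all the scalar weights involved being of the same type (shifted Hermite, Laguerre, or Jacobi), such that $w_{i,j}\sim w_{i,\ell}$ for all $i,j,\ell$, and $w_{i,\ell}\not\sim w_{r,j}$ for all $\ell,j$ and $i\ne r$, where $\sim$ denotes Darboux equivalence. Let $\delta_{i,j}$ denote the second-order differential operator associated with $w_{i,j}$, and let $\Delta_i=\operatorname{diag}(\delta_{i,1},\dots,\delta_{i,k_i})$. Then the center of $\mathcal D(W)$ is $$\mathcal Z(W)=\bigoplus_{i=1}^m\mathcal Z(W_i)=\mathbb C[\Delta_1]\oplus\cdots\oplus\mathbb C[\Delta_m],$$ that is, the set of block-diagonal operators with diagonal blocks $p_1(\Delta_1),\dots,p_m(\Delta_m)$ for arbitrary $p_1,\dots,p_m\in\mathbb C[x]$.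
   Context: For a weight matrix $W$ of size $N$ (smooth, positive definite a.e. on an interval, finite moments), $\{P_n\}$ denotes the monic matrix polynomials orthogonal for $\langle P,Q\rangle_W=\int P(x)W(x)Q(x)^*dx$. Differential operators $D=\sum_{j}\partial^jF_j(x)$ with polynomial (matrix) coefficients, forming the algebra $\operatorname{Mat}_N(\Omega[x])$, act on the right: $P\cdot D=\sum_j\partial^j(P)F_j$, and $P\cdot(D_1D_2)=(P\cdot D_1)\cdot D_2$. $\mathcal D(W)=\{D\in\operatorname{Mat}_N(\Omega[x]):\text{for all }n\ge0,\ P_n\cdot D=\Lambda_n(D)P_n\text{ for some }\Lambda_n(D)\in\operatorname{Mat}_N(\mathbb C)\}$, and $\mathcal Z(W)$ is its center. Classical scalar weights and their second-order operators: shifted Hermite $w_b(x)=e^{-x^2+2bx}$ on $(-\infty,\infty)$, $\delta=\partial^2-2\partial(x-b)$; Laguerre $w_\alpha(x)=e^{-x}x^\alpha$ on $(0,\infty)$, $\alpha>-1$, $\delta=\partial^2x+\partial(\alpha+1-x)$; Jacobi $w_{\alpha,\beta}(x)=(1-x)^\alpha(1+x)^\beta$ on $(-1,1)$, $\alpha,\beta>-1$, $\delta=\partial^2(1-x^2)+\partial(\beta-\alpha-x(\alpha+\beta+2))$. Darboux equivalence: an operator is degree-preserving if $\deg(P\cdot\mathcal V)=\deg P$ for all polynomials $P$; $\tilde w$ is a Darboux transformation of $w$ (same support, monic orthogonal polynomials $\tilde p_n$, $p_n$), written $w\sim\tilde w$, if some $D\in\mathcal D(w)$ factors as $D=\mathcal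 V\mathcal N$ with $\mathcal V,\mathcal N$ degree-preserving operators with polynomial coefficients and $p_n\cdot\mathcal V=a_n\tilde p_n$, $a_n\in\mathbb C$, for all $n\ge0$. This is an equivalence relation. For classical weights: $w_a,w_b$ shifted Hermite are equivalent iff $a=b$; Laguerre $w_\alpha,w_{\tilde\alpha}$ iff $\alpha-\tilde\alpha\in\mathbb Z$; Jacobi $w_{\alpha,\beta},w_{\tilde\alpha,\tilde\beta}$ iff $\alpha+\beta=\tilde\alpha+\tilde\beta$ and $\alpha-\tilde\alpha\in\mathbb Z$. *)

theory Defs
  imports
    "HOL-Analysis.Analysis"
    "Jordan_Normal_Form.Schur_Decomposition"
begin

section \<open>Scalar differential operators with polynomial coefficients\<close>

text \<open>
  An operator \<open>\<Sum>j\<le>n. \<partial>\<^sup>j f\<^sub>j(x)\<close> is identified with the map it induces on polynomials.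
  In characteristic 0 this map determines the coefficients, so the identification loses nothing.
\<close>

definition diffop_fun :: "nat \<Rightarrow> (nat \<Rightarrow> complex poly) \<Rightarrow> complex poly \<Rightarrow> complex poly" where
  "diffop_fun n f = (\<lambda>p. \<Sum>j\<le>n. (pderiv ^^ j) p * f j)"

lemma diffop_fun_extend:
  assumes "n \<le> m"
  shows "diffop_fun n f = diffop_fun m (\<lambda>j. if j \<le> n then f j else 0)"
proof
  fix p
  show "diffop_fun n f p = diffop_fun m (\<lambda>j. if j \<le> n then f j else 0) p"
    unfolding diffop_fun_def using assms by (intro sum.mono_neutral_cong_left) auto
qed

lemma diffop_fun_zero: "\<exists>n f. (\<lambda>p. 0) = diffop_fun n f"
  by (rule exI[of _ 0], rule exI[of _ "\<lambda>_. 0"]) (simp add: diffop_fun_def)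

lemma diffop_fun_id: "\<exists>n f. (\<lambda>p. p) = diffop_fun n f"
  by (rule exI[of _ 0], rule exI[of _ "\<lambda>_. 1"]) (simp add: diffop_fun_def)

lemma diffop_fun_add: "\<exists>n h. (\<lambda>p. diffop_fun a f p + diffop_fun b g p) = diffop_fun n h"
proof -
  define m where "m = max a b"
  obtain f' where f': "diffop_fun a f = diffop_fun m f'"
    using diffop_fun_extend[of a m f] by (auto simp: m_def)
  obtain g' where g': "diffop_fun b g = diffop_fun m g'"
    using diffop_fun_extend[of b m g] by (auto simp: m_def)
  show ?thesis unfolding f' g'
    by (rule exI[of _ m], rule exI[of _ "\<lambda>j. f' j + g' j"])
       (simp add: diffop_fun_def fun_eq_iff sum.distrib distrib_left)
qed

lemma diffop_fun_mult: "(\<lambda>p. diffop_fun a f p * q) = diffop_fun a (\<lambda>j. f j * q)"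
  by (simp add: diffop_fun_def fun_eq_iff sum_distrib_right mult.assoc)

lemma diffop_fun_pderiv: "\<exists>n h. (\<lambda>p. pderiv (diffop_fun a f p)) = diffop_fun n h"
proof -
  have *: "pderiv (diffop_fun a f p) =
      diffop_fun (Suc a) (\<lambda>j. if j = 0 then 0 else f (j - 1)) p + diffop_fun a (\<lambda>j. pderiv (f j)) p" for p
  proof -
    have "diffop_fun (Suc a) (\<lambda>j. if j = 0 then 0 else f (j - 1)) p =
        (\<Sum>j\<le>a. (pderiv ^^ Suc j) p * f j)"
      unfolding diffop_fun_def by (subst sum.atMost_Suc_shift) simp
    then show ?thesis
      by (simp add: diffop_fun_def higher_pderiv_add sum.distrib pderiv_mult
          pderiv_sum algebra_simps)
  qed
  show ?thesis unfolding * by (rule diffop_fun_add)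
qed

lemma diffop_fun_comp: "\<exists>n h. (\<lambda>p. diffop_fun b g (diffop_fun a f p)) = diffop_fun n h"
proof -
  have der: "\<exists>n h. (\<lambda>p. (pderiv ^^ j) (diffop_fun a f p)) = diffop_fun n h" for j
  proof (induction j)
    case (Suc j)
    then obtain n h where "(\<lambda>p. (pderiv ^^ j) (diffop_fun a f p)) = diffop_fun n h" by blast
    then have "(\<lambda>p. (pderiv ^^ Suc j) (diffop_fun a f p)) = (\<lambda>p. pderiv (diffop_fun n h p))"
      by (simp add: fun_eq_iff)
    then show ?case using diffop_fun_pderiv by simp
  qed auto
  have summand: "\<exists>n h. (\<lambda>p. (pderiv ^^ j) (diffop_fun a f p) * g j) = diffop_fun n h" for j
  proof -
    obtain n h where "(\<lambda>p. (pderiv ^^ j) (diffop_fun a f p)) = diffop_fun n h" using der by blast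
    then have "(\<lambda>p. (pderiv ^^ j) (diffop_fun a f p) * g j) = (\<lambda>p. diffop_fun n h p * g j)"
      by (simp add: fun_eq_iff)
    then show ?thesis using diffop_fun_mult by metis
  qed
  have "\<exists>n h. (\<lambda>p. \<Sum>j\<le>b. (pderiv ^^ j) (diffop_fun a f p) * g j) = diffop_fun n h"
  proof (induction b)
    case 0
    then show ?case using summand[of 0] by simp
  next
    case (Suc b)
    obtain n h where 1: "\<And>p. (\<Sum>j\<le>b. (pderiv ^^ j) (diffop_fun a f p) * g j) = diffop_fun n h p"
      using Suc unfolding fun_eq_iff by blast
    obtain n' h' where 2: "\<And>p. (pderiv ^^ Suc b) (diffop_fun a f p) * g (Suc b) = diffop_fun n' h' p"
      using summand[of "Suc b"] unfolding fun_eq_iff by blast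
    show ?case unfolding sum.atMost_Suc 1 2 by (rule diffop_fun_add)
  qed
  then show ?thesis by (simp add: diffop_fun_def[of b])
qed

lemma diffop_fun_minus: "\<exists>n h. (\<lambda>p. - diffop_fun a f p) = diffop_fun n h"
  by (rule exI[of _ a], rule exI[of _ "\<lambda>j. - f j"]) (simp add: diffop_fun_def fun_eq_iff sum_negf)

lemma diffop_fun_linear: "diffop_fun a f (p + q) = diffop_fun a f p + diffop_fun a f q"
  by (simp add: diffop_fun_def higher_pderiv_add sum.distrib distrib_right)

typedef diffop = "{T. \<exists>n f. T = diffop_fun n f}"
  morphisms act diffop_of
  using diffop_fun_zero by blast

setup_lifting type_definition_diffop

lemma act_add_arg: "act D (p + q) = act D p + act D q"
  using act[of D] by (auto simp: diffop_fun_linear)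

lemma act_0_arg: "act D 0 = 0"
  using act_add_arg[of D 0 0] by simp

text \<open>
  Operators act on the right, \<open>p \<cdot> D = act D p\<close>, so \<open>D * E\<close> applies \<open>D\<close> first:
  \<open>p \<cdot> (D * E) = (p \<cdot> D) \<cdot> E\<close>.
\<close>

instantiation diffop :: ring_1
begin

lift_definition zero_diffop :: diffop is "\<lambda>p. 0" by (rule diffop_fun_zero)
lift_definition one_diffop :: diffop is "\<lambda>p. p" by (rule diffop_fun_id)
lift_definition plus_diffop :: "diffop \<Rightarrow> diffop \<Rightarrow> diffop" is "\<lambda>S T p. S p + T p"
  using diffop_fun_add by blast
lift_definition uminus_diffop :: "diffop \<Rightarrow> diffop" is "\<lambda>S p. - S p"
  using diffop_fun_minus by blast
definition minus_diffop :: "diffop \<Rightarrow> diffop \<Rightarrow> diffop" where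
  "minus_diffop S T = S + - T"
lift_definition times_diffop :: "diffop \<Rightarrow> diffop \<Rightarrow> diffop" is "\<lambda>S T p. T (S p)"
  using diffop_fun_comp by blast

instance
proof
  fix a b c :: diffop
  show "a + b + c = a + (b + c)" by transfer (simp add: add.assoc)
  show "a + b = b + a" by transfer (simp add: add.commute)
  show "0 + a = a" by transfer simp
  show "- a + a = 0" by transfer simp
  show "a - b = a + - b" by (rule minus_diffop_def)
  show "a * b * c = a * (b * c)" by transfer simp
  show "1 * a = a" by transfer simp
  show "a * 1 = a" by transfer simp
  show "(a + b) * c = a * c + b * c" by transfer (auto simp: diffop_fun_linear)
  show "a * (b + c) = a * b + a * c" by transfer simp
  have "act 0 1 = 0" "act 1 1 = 1" by (simp_all add: zero_diffop.rep_eq one_diffop.rep_eq)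
  then show "(0::diffop) \<noteq> 1" by auto
qed

end

lift_definition deriv_op :: diffop is pderiv
  using diffop_fun_pderiv[of 0 "\<lambda>_. 1"] by (simp add: diffop_fun_def)

lift_definition mult_op :: "complex poly \<Rightarrow> diffop" is "\<lambda>f (p :: complex poly). p * f"
proof -
  fix f :: "complex poly"
  have "(\<lambda>p. p * f) = diffop_fun 0 (\<lambda>_. f)" by (simp add: diffop_fun_def)
  then show "\<exists>n g. (\<lambda>p. p * f) = diffop_fun n g" by blast
qed


section \<open>Matrix operators, orthogonal polynomials and the algebra \<open>\<D>(W)\<close>\<close>

text \<open>
  Elements of \<open>Mat\<^sub>N(\<Omega>[x])\<close> are matrices with entries in \<^typ>\<open>diffop\<close>, which are
  \<open>\<Sum>j. \<partial>\<^sup>j F\<^sub>j(x)\<close> written entrywise; the action is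
  \<open>(P \<cdot> D)\<^sub>i\<^sub>j = \<Sum>k. P\<^sub>i\<^sub>k \<cdot> D\<^sub>k\<^sub>j\<close>.
\<close>

definition mat_act :: "complex poly mat \<Rightarrow> diffop mat \<Rightarrow> complex poly mat" where
  "mat_act P D = mat (dim_row P) (dim_col D)
     (\<lambda>(i, j). \<Sum>k<dim_row D. act (D $$ (k, j)) (P $$ (i, k)))"

text \<open>A weight matrix is a function on all of the real line that vanishes off its interval.\<close>

type_synonym weight_matrix = "real \<Rightarrow> complex mat"

definition eval_mat :: "complex poly mat \<Rightarrow> real \<Rightarrow> complex mat" where
  "eval_mat P x = map_mat (\<lambda>p. poly p (complex_of_real x)) P"

definition weight_inner ::
  "nat \<Rightarrow> weight_matrix \<Rightarrow> complex poly mat \<Rightarrow> complex poly mat \<Rightarrow> complex mat" where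
  "weight_inner N W P Q = mat N N
     (\<lambda>(i, j). LINT x|lborel. (eval_mat P x * W x * mat_adjoint (eval_mat Q x)) $$ (i, j))"

definition monic_of_degree :: "nat \<Rightarrow> nat \<Rightarrow> complex poly mat \<Rightarrow> bool" where
  "monic_of_degree N n P \<longleftrightarrow>
     P \<in> carrier_mat N N \<and>
     (\<forall>i<N. \<forall>j<N. degree (P $$ (i, j)) \<le> n) \<and>
     map_mat (\<lambda>p. coeff p n) P = 1\<^sub>m N"

definition is_monic_orthogonal ::
  "nat \<Rightarrow> weight_matrix \<Rightarrow> (nat \<Rightarrow> complex poly mat) \<Rightarrow> bool" where
  "is_monic_orthogonal N W P \<longleftrightarrow>
     (\<forall>n. monic_of_degree N n (P n)) \<and>
     (\<forall>n k. n \<noteq> k \<longrightarrow> weight_inner N W (P n) (P k) = 0\<^sub>m N N)"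

definition monic_orthogonal :: "nat \<Rightarrow> weight_matrix \<Rightarrow> nat \<Rightarrow> complex poly mat" where
  "monic_orthogonal N W = (THE P. is_monic_orthogonal N W P)"

definition diffop_algebra :: "nat \<Rightarrow> weight_matrix \<Rightarrow> diffop mat set" where
  "diffop_algebra N W = {D \<in> carrier_mat N N.
     \<forall>n. \<exists>\<Lambda> \<in> carrier_mat N N.
       mat_act (monic_orthogonal N W n) D =
       map_mat (\<lambda>c. [:c:]) \<Lambda> * monic_orthogonal N W n}"

definition diffop_center :: "nat \<Rightarrow> weight_matrix \<Rightarrow> diffop mat set" where
  "diffop_center N W =
     {D \<in> diffop_algebra N W. \<forall>E \<in> diffop_algebra N W. D * E = E * D}"


section \<open>Darboux equivalence of scalar weights\<close>

text \<open>A scalar weight is treated as a weight matrix of size 1.\<close>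

definition scalar_matrix :: "(real \<Rightarrow> real) \<Rightarrow> weight_matrix" where
  "scalar_matrix w x = mat 1 1 (\<lambda>_. complex_of_real (w x))"

definition scalar_orthogonal :: "(real \<Rightarrow> real) \<Rightarrow> nat \<Rightarrow> complex poly" where
  "scalar_orthogonal w n = monic_orthogonal 1 (scalar_matrix w) n $$ (0, 0)"

definition scalar_diffop_algebra :: "(real \<Rightarrow> real) \<Rightarrow> diffop set" where
  "scalar_diffop_algebra w = {D. mat 1 1 (\<lambda>_. D) \<in> diffop_algebra 1 (scalar_matrix w)}"

text \<open>
  Here \<open>degree 0 = 0\<close>, whereas the zero polynomial should not count as having the degree of a
  nonzero constant; hence the explicit condition \<open>act V p \<noteq> 0\<close>.
\<close>

definition degree_preserving :: "diffop \<Rightarrow> bool" where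
  "degree_preserving V \<longleftrightarrow> (\<forall>p. p \<noteq> 0 \<longrightarrow> act V p \<noteq> 0 \<and> degree (act V p) = degree p)"

definition weight_support :: "(real \<Rightarrow> real) \<Rightarrow> real set" where
  "weight_support w = closure {x. w x \<noteq> 0}"

definition darboux :: "(real \<Rightarrow> real) \<Rightarrow> (real \<Rightarrow> real) \<Rightarrow> bool" where
  "darboux w v \<longleftrightarrow>
     weight_support w = weight_support v \<and>
     (\<exists>D \<in> scalar_diffop_algebra w. \<exists>V N.
        D = V * N \<and> degree_preserving V \<and> degree_preserving N \<and>
        (\<forall>n. \<exists>a. act V (scalar_orthogonal w n) = Polynomial.smult a (scalar_orthogonal v n)))"


section \<open>Classical weights\<close>

datatype classical =
    is_Hermite: Hermite real
  | is_Laguerre: Laguerre real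
  | is_Jacobi: Jacobi real real

fun admissible :: "classical \<Rightarrow> bool" where
  "admissible (Hermite b) \<longleftrightarrow> True"
| "admissible (Laguerre \<alpha>) \<longleftrightarrow> \<alpha> > -1"
| "admissible (Jacobi \<alpha> \<beta>) \<longleftrightarrow> \<alpha> > -1 \<and> \<beta> > -1"

fun weight :: "classical \<Rightarrow> real \<Rightarrow> real" where
  "weight (Hermite b) x = exp (- (x ^ 2) + 2 * b * x)"
| "weight (Laguerre \<alpha>) x = (if x > 0 then exp (- x) * x powr \<alpha> else 0)"
| "weight (Jacobi \<alpha> \<beta>) x =
     (if -1 < x \<and> x < 1 then (1 - x) powr \<alpha> * (1 + x) powr \<beta> else 0)"

fun classical_op :: "classical \<Rightarrow> diffop" where
  "classical_op (Hermite b) =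
     deriv_op ^ 2 - 2 * deriv_op * mult_op [:- of_real b, 1:]"
| "classical_op (Laguerre \<alpha>) =
     deriv_op ^ 2 * mult_op [:0, 1:] + deriv_op * mult_op [:of_real \<alpha> + 1, -1:]"
| "classical_op (Jacobi \<alpha> \<beta>) =
     deriv_op ^ 2 * mult_op [:1, 0, -1:]
     + deriv_op * mult_op [:of_real \<beta> - of_real \<alpha>, - (of_real \<alpha> + of_real \<beta> + 2):]"

definition same_type :: "classical set \<Rightarrow> bool" where
  "same_type C \<longleftrightarrow>
     (\<forall>c\<in>C. is_Hermite c) \<or> (\<forall>c\<in>C. is_Laguerre c) \<or> (\<forall>c\<in>C. is_Jacobi c)"


section \<open>Direct sums\<close>

definition direct_sum :: "weight_matrix list \<Rightarrow> weight_matrix" where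
  "direct_sum Ws x = diag_block_mat (map (\<lambda>W. W x) Ws)"

definition classical_sum :: "classical list \<Rightarrow> weight_matrix" where
  "classical_sum cs = direct_sum (map (\<lambda>c. scalar_matrix (weight c)) cs)"

definition classical_diag_op :: "classical list \<Rightarrow> diffop mat" where
  "classical_diag_op cs = mat_diag (length cs) (\<lambda>j. classical_op (cs ! j))"

definition poly_op :: "complex poly \<Rightarrow> diffop mat \<Rightarrow> diffop mat" where
  "poly_op p A = mat (dim_row A) (dim_row A)
     (\<lambda>(i, j). \<Sum>k\<le>degree p. mult_op [:coeff p k:] * (A ^\<^sub>m k) $$ (i, j))"

definition poly_algebra :: "diffop mat \<Rightarrow> diffop mat set" where
  "poly_algebra A = range (\<lambda>p. poly_op p A)"

text \<open>\<^const>\<open>listset\<close> gives all lists whose \<open>i\<close>-th entry lies in the \<open>i\<close>-th set.\<close>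

definition block_direct_sum :: "diffop mat set list \<Rightarrow> diffop mat set" where
  "block_direct_sum As = diag_block_mat ` listset As"

end

theory Submission
  imports Defs
    "HOL-Computational_Algebra.Field_as_Ring"
    "HOL-Computational_Algebra.Polynomial_Factorial"
    "HOL-Probability.Distributions"
begin

text \<open>
  Write \<open>p\<^sub>n\<close> for the monic orthogonal polynomials of a classical weight; they are the eigenpolynomials of
  \<open>\<delta> : p \<mapsto> a p'' + b p'\<close>, with eigenvalues \<open>\<nu>\<^sub>n\<close>. For a diagonal weight the orthogonal matrix polynomials are
  diagonal (\<open>monic_orthogonal_classical_sum\<close>), so an operator \<open>D\<close> lies in \<open>\<D>(W)\<close> exactly if every entry
  \<open>D\<^sub>i\<^sub>j\<close> is an intertwiner: it sends the \<open>n\<close>-th polynomial of the \<open>i\<close>-th weight to a multiple of the \<open>n\<close>-th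
  polynomial of the \<open>j\<close>-th one. The theorem is therefore a statement about scalar intertwiners.

  The main tool is a normal form. By the eigenvalue equation, every operator \<open>D\<close> satisfies
  \<open>a\<^sup>r (p\<^sub>n \<cdot> D) = U(\<nu>\<^sub>n) p\<^sub>n' + V(\<nu>\<^sub>n) p\<^sub>n\<close> with polynomials \<open>U\<close> and \<open>V\<close> in \<open>x\<close> and \<open>\<nu>\<close> that do not depend on \<open>n\<close>
  (\<open>reduce_diffop\<close>). As \<open>p\<^sub>n\<close> has only simple zeros, this form is unique for large \<open>n\<close>
  (\<open>reduced_form_unique\<close>). If \<open>D\<close> is an intertwiner of a weight with itself, it follows that its eigenvalue
  is a polynomial in \<open>\<nu>\<^sub>n\<close>, and so \<open>\<D>(w) = \<complex>[\<delta>]\<close> (\<open>commutant_classical_op\<close>). If \<open>D\<close> intertwines two Jacobi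
  weights with different \<open>\<alpha> + \<beta>\<close>, then a commutator acts as a multiple of \<open>n D\<close>, and a parity argument in \<open>n\<close>
  gives \<open>D = 0\<close> (\<open>intertwines_Jacobi_sum\<close>).

  Hence a nonzero intertwiner between weights of the same type relates polynomials with equal eigenvalues,
  and so it satisfies \<open>\<delta> D = D \<delta>'\<close>. Comparing leading coefficients yields a first-order equation that
  has nonzero polynomial solutions only if the parameters differ by integers, or not at all in the Hermite
  case (\<open>intertwiner_integer_shift\<close>). Conversely, first-order ladder operators realise all such shifts in
  both directions and preserve degrees (\<open>integer_shift_imp_darboux_maps\<close>). So two weights of the same type are Darboux equivalent if and only if there is a nonzero intertwiner between them.

  For the center this means the following. Commuting with the diagonal matrix units makes a central element
  diagonal, with entries \<open>q\<^sub>i(\<delta>\<^sub>i)\<close>. Inside a block the ladder operators are entries of elements of the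
  algebra, and commuting with them makes all \<open>q\<^sub>i\<close> equal. Between blocks all entries of the algebra vanish,
  so the polynomials of different blocks are independent (\<open>diffop_center_classical_sum\<close>).
\<close>

section \<open>Classical operators and their eigenpolynomials\<close>

lemmas act_simps = plus_diffop.rep_eq times_diffop.rep_eq zero_diffop.rep_eq one_diffop.rep_eq
  uminus_diffop.rep_eq deriv_op.rep_eq mult_op.rep_eq

lemma act_minus: "act (D - E) p = act D p - act E p"
  by (simp only: minus_diffop_def act_simps) simp

lemma act_smult_arg: "act D (Polynomial.smult c p) = Polynomial.smult c (act D p)"
proof -
  have "(pderiv ^^ j) (Polynomial.smult c p) = Polynomial.smult c ((pderiv ^^ j) p)" for j
    by (induction j) (auto simp: pderiv_smult)
  then have "diffop_fun n f (Polynomial.smult c p) = Polynomial.smult c (diffop_fun n f p)" for n f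
    by (simp add: diffop_fun_def smult_sum2)
  then show ?thesis using act[of D] by auto
qed

lemma act_minus_arg: "act D (p - q) = act D p - act D q"
  by (metis act_add_arg add_diff_cancel diff_add_cancel)

text \<open>
  The classical operator acts by \<open>p \<mapsto> a p'' + b p'\<close>; this is \<open>a\<close>, which depends on the type only,
  and \<open>sub_coeff\<close> is \<open>b\<close>.
\<close>

fun top_coeff :: "classical \<Rightarrow> complex poly" where
  "top_coeff (Hermite b) = 1"
| "top_coeff (Laguerre \<alpha>) = [:0, 1:]"
| "top_coeff (Jacobi \<alpha> \<beta>) = [:1, 0, -1:]"

fun sub_coeff :: "classical \<Rightarrow> complex poly" where
  "sub_coeff (Hermite b) = [:2 * of_real b, -2:]"
| "sub_coeff (Laguerre \<alpha>) = [:of_real \<alpha> + 1, -1:]"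
| "sub_coeff (Jacobi \<alpha> \<beta>) = [:of_real \<beta> - of_real \<alpha>, - (of_real \<alpha> + of_real \<beta> + 2):]"

fun eigval :: "classical \<Rightarrow> nat \<Rightarrow> complex" where
  "eigval (Hermite b) n = - 2 * of_nat n"
| "eigval (Laguerre \<alpha>) n = - of_nat n"
| "eigval (Jacobi \<alpha> \<beta>) n = - of_nat n * (of_nat n + of_real \<alpha> + of_real \<beta> + 1)"

lemma act_classical_op:
  "act (classical_op c) p = top_coeff c * pderiv (pderiv p) + sub_coeff c * pderiv p"
proof (cases c)
  case (Hermite b)
  have "(2::diffop) = 1 + 1" by simp
  then have two: "act (2::diffop) r = Polynomial.smult 2 r" for r
    by (simp only: act_simps) (simp add: numeral_poly)
  show ?thesis
    by (simp add: Hermite act_simps act_minus power2_eq_square pderiv_smult two algebra_simps)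
qed (simp_all add: act_simps act_minus power2_eq_square algebra_simps)

lemma coeff_quadratic_mult:
  "coeff ([:u, v, w:] * p) n =
     u * coeff p n + (if n = 0 then 0 else v * coeff p (n - 1)) + (if n < 2 then 0 else w * coeff p (n - 2))"
  by (auto simp: coeff_pCons numeral_2_eq_2 add.assoc split: nat.split)

lemma coeff_act_classical_op:
  "coeff (act (classical_op c) p) n =
     coeff (top_coeff c) 0 * of_nat ((n + 2) * (n + 1)) * coeff p (n + 2)
     + (coeff (top_coeff c) 1 * of_nat n + coeff (sub_coeff c) 0) * of_nat (n + 1) * coeff p (n + 1)
     + eigval c n * coeff p n"
proof -
  define u v w where "u = coeff (top_coeff c) 0" and "v = coeff (top_coeff c) 1" and "w = coeff (top_coeff c) 2"
  define r s where "r = coeff (sub_coeff c) 0" and "s = coeff (sub_coeff c) 1"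
  have top: "top_coeff c = [:u, v, w:]"
    by (cases c) (simp_all add: u_def v_def w_def one_pCons numeral_2_eq_2)
  have sub: "sub_coeff c = [:r, s, 0:]"
    by (cases c) (simp_all add: r_def s_def)
  have eig: "eigval c n = of_nat n * (of_nat n - 1) * w + of_nat n * s"
    by (cases c) (simp_all add: w_def s_def one_pCons numeral_2_eq_2, simp add: algebra_simps)
  have "act (classical_op c) p = [:u, v, w:] * pderiv (pderiv p) + [:r, s, 0:] * pderiv p"
    by (simp only: act_classical_op top sub)
  then have *: "coeff (act (classical_op c) p) n =
      u * coeff (pderiv (pderiv p)) n
      + (if n = 0 then 0 else v * coeff (pderiv (pderiv p)) (n - 1))
      + (if n < 2 then 0 else w * coeff (pderiv (pderiv p)) (n - 2))
      + (r * coeff (pderiv p) n + (if n = 0 then 0 else s * coeff (pderiv p) (n - 1)))"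
    by (simp only: coeff_add coeff_quadratic_mult) simp
  consider "n = 0" | "n = 1" | k where "n = Suc (Suc k)"
    by (metis One_nat_def not0_implies_Suc)
  then show ?thesis
    unfolding * eig unfolding top sub
    by cases (simp_all add: coeff_pderiv algebra_simps)
qed

lemma eigval_inj:
  assumes "admissible c" "eigval c m = eigval c n"
  shows "m = n"
proof (cases c)
  case (Jacobi \<alpha> \<beta>)
  have "complex_of_real (real m * (real m + \<alpha> + \<beta> + 1)) = complex_of_real (real n * (real n + \<alpha> + \<beta> + 1))"
    using assms Jacobi by simp
  then have "real m * (real m + \<alpha> + \<beta> + 1) = real n * (real n + \<alpha> + \<beta> + 1)"
    using of_real_eq_iff by blast
  then have "(real m - real n) * (real m + real n + \<alpha> + \<beta> + 1) = 0"
    by (simp add: algebra_simps)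
  moreover have "real m + real n + \<alpha> + \<beta> + 1 > 0" if "m \<noteq> n"
  proof -
    have "real m + real n \<ge> 1" using that by linarith
    then show ?thesis using assms(1) Jacobi by simp
  qed
  ultimately show ?thesis by fastforce
qed (use assms in auto)

text \<open>
  The operator is triangular on monomials with diagonal entries \<open>eigval c k\<close>, so subtracting the
  eigenvalue at \<open>n\<close> leaves it invertible on polynomials of degree below \<open>n\<close>: the leading term of
  the right-hand side is matched by a monomial, and the rest has smaller degree.
\<close>

lemma resolvent_exists:
  assumes "admissible c" "m \<le> n" "\<forall>k\<ge>m. coeff p k = 0"
  shows "\<exists>r. (\<forall>k\<ge>m. coeff r k = 0) \<and>
             act (classical_op c) r - Polynomial.smult (eigval c n) r = p"
  using assms(2,3)
proof (induction m arbitrary: p)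
  case 0
  then have "p = 0" by (simp add: poly_eq_iff)
  then show ?case by (intro exI[of _ 0]) (simp add: act_0_arg)
next
  case (Suc m)
  define e where "e = eigval c m - eigval c n"
  have e: "e \<noteq> 0" using eigval_inj[OF assms(1), of m n] Suc.prems by (auto simp: e_def)
  define r0 where "r0 = Polynomial.monom (coeff p m / e) m"
  define L where "L r = act (classical_op c) r - Polynomial.smult (eigval c n) r" for r
  have "coeff (p - L r0) k = 0" if "k \<ge> m" for k
    using that Suc.prems(2) e
    by (auto simp: L_def coeff_act_classical_op r0_def e_def field_simps)
  then obtain r where r: "\<forall>k\<ge>m. coeff r k = 0" "L r = p - L r0"
    using Suc.IH[of "p - L r0"] Suc.prems by (auto simp: L_def)
  show ?case
  proof (intro exI[of _ "r0 + r"] conjI)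
    show "\<forall>k\<ge>Suc m. coeff (r0 + r) k = 0" using r by (auto simp: r0_def)
    show "act (classical_op c) (r0 + r) - Polynomial.smult (eigval c n) (r0 + r) = p"
      using r(2) by (simp add: L_def act_add_arg smult_add_right algebra_simps)
  qed
qed

definition eigenpoly :: "classical \<Rightarrow> nat \<Rightarrow> complex poly" where
  "eigenpoly c n = (SOME p. degree p = n \<and> coeff p n = 1 \<and>
     act (classical_op c) p = Polynomial.smult (eigval c n) p)"

lemma eigenpoly:
  assumes "admissible c"
  shows degree_eigenpoly: "degree (eigenpoly c n) = n"
    and coeff_eigenpoly: "coeff (eigenpoly c n) n = 1"
    and act_eigenpoly: "act (classical_op c) (eigenpoly c n) = Polynomial.smult (eigval c n) (eigenpoly c n)"
    and eigenpoly_nonzero: "eigenpoly c n \<noteq> 0"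
proof -
  define x where "x = Polynomial.monom (1::complex) n"
  define p where "p = Polynomial.smult (eigval c n) x - act (classical_op c) x"
  have "\<forall>k\<ge>n. coeff p k = 0"
    by (auto simp: p_def x_def coeff_act_classical_op)
  then obtain r where r: "\<forall>k\<ge>n. coeff r k = 0"
    "act (classical_op c) r - Polynomial.smult (eigval c n) r = p"
    using resolvent_exists[OF assms order_refl] by blast
  have cf: "coeff (x + r) n = 1" using r by (simp add: x_def)
  moreover have "degree (x + r) = n"
    using r cf by (intro antisym degree_le le_degree) (auto simp: x_def)
  moreover have "act (classical_op c) (x + r) = Polynomial.smult (eigval c n) (x + r)"
    using r(2) by (simp add: p_def act_add_arg smult_add_right algebra_simps)
  ultimately have "\<exists>p. degree p = n \<and> coeff p n = 1 \<and>
     act (classical_op c) p = Polynomial.smult (eigval c n) p" by blast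
  from someI_ex[OF this] show "degree (eigenpoly c n) = n" "coeff (eigenpoly c n) n = 1"
    "act (classical_op c) (eigenpoly c n) = Polynomial.smult (eigval c n) (eigenpoly c n)"
    unfolding eigenpoly_def by auto
  then show "eigenpoly c n \<noteq> 0" by (metis coeff_0 zero_neq_one)
qed

text \<open>
  The eigenvalues are distinct, so the degree of an eigenpolynomial can be read off its eigenvalue;
  subtracting the right multiple of \<open>eigenpoly c n\<close> lowers the degree and hence leaves nothing.
\<close>

lemma eigenpoly_unique:
  assumes c: "admissible c"
    and p: "act (classical_op c) p = Polynomial.smult (eigval c n) p"
  shows "\<exists>a. p = Polynomial.smult a (eigenpoly c n)"
proof -
  have deg: "degree r = n"
    if "act (classical_op c) r = Polynomial.smult (eigval c n) r" "r \<noteq> 0" for r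
  proof -
    have "coeff (act (classical_op c) r) (degree r) = eigval c (degree r) * lead_coeff r"
      by (simp add: coeff_act_classical_op coeff_eq_0)
    then have "eigval c (degree r) = eigval c n" using that by simp
    then show ?thesis using eigval_inj[OF c] by blast
  qed
  define r where "r = p - Polynomial.smult (coeff p n) (eigenpoly c n)"
  have "act (classical_op c) r = Polynomial.smult (eigval c n) r"
    by (simp add: r_def act_minus_arg act_smult_arg p act_eigenpoly[OF c] smult_diff_right mult.commute)
  moreover have "coeff r n = 0" by (simp add: r_def coeff_eigenpoly[OF c])
  ultimately have "r = 0" using deg[of r] leading_coeff_0_iff by blast
  then show ?thesis by (auto simp: r_def)
qed

lemma eigenpoly_span_induct:
  assumes c: "admissible c"
    and eig: "\<And>a n. P (Polynomial.smult a (eigenpoly c n))"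
    and add: "\<And>p q. P p \<Longrightarrow> P q \<Longrightarrow> P (p + q)"
  shows "P p"
proof -
  have "P p" if "\<forall>k\<ge>m. coeff p k = 0" for m p
    using that
  proof (induction m arbitrary: p)
    case 0
    then have "p = Polynomial.smult 0 (eigenpoly c 0)" by (simp add: poly_eq_iff)
    then show ?case using eig by metis
  next
    case (Suc m)
    let ?q = "Polynomial.smult (coeff p m) (eigenpoly c m)"
    have "coeff (p - ?q) k = 0" if "k \<ge> m" for k
      using that Suc.prems degree_eigenpoly[OF c, of m] coeff_eigenpoly[OF c, of m]
      by (cases "k = m") (auto simp: coeff_eq_0)
    then have "P (p - ?q)" using Suc.IH by blast
    then show ?case using add[of "p - ?q" ?q] eig by simp
  qed
  then show ?thesis using coeff_eq_0[of p] by (metis Suc_le_eq)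
qed

text \<open>
  The eigenpolynomials have one member in each degree and so form a basis; operator identities are
  checked on them throughout.
\<close>

lemma diffop_eqI:
  assumes c: "admissible c" and eq: "\<And>n. act D (eigenpoly c n) = act E (eigenpoly c n)"
  shows "D = E"
proof -
  have "act D p = act E p" for p
    by (induction p rule: eigenpoly_span_induct[OF c]) (auto simp: act_smult_arg act_add_arg eq)
  then show ?thesis by (metis act_inject ext)
qed

section \<open>Reduction modulo the eigenvalue equation\<close>

text \<open>
  The Leibniz rule stops early, because \<open>a''\<close> and \<open>b'\<close> are constant. The two leading coefficients govern
  the zeros of the eigenpolynomials and the leading coefficients of intertwiners; the third one is hidden
  behind an existential quantifier.
\<close>

lemma higher_pderiv_act_classical_op:
  "\<exists>h. pderiv h = 0 \<and> (\<forall>p. (pderiv ^^ m) (act (classical_op c) p) =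
     top_coeff c * (pderiv ^^ (m + 2)) p
     + (of_nat m * pderiv (top_coeff c) + sub_coeff c) * (pderiv ^^ (m + 1)) p
     + h * (pderiv ^^ m) p)"
proof (induction m)
  case 0
  show ?case by (intro exI[of _ 0]) (simp add: act_classical_op numeral_2_eq_2)
next
  case (Suc m)
  then obtain h where h: "pderiv h = 0" and eq: "\<And>p. (pderiv ^^ m) (act (classical_op c) p) =
     top_coeff c * (pderiv ^^ (m + 2)) p
     + (of_nat m * pderiv (top_coeff c) + sub_coeff c) * (pderiv ^^ (m + 1)) p
     + h * (pderiv ^^ m) p" by blast
  have top: "pderiv (pderiv (pderiv (top_coeff c))) = 0" and sub: "pderiv (pderiv (sub_coeff c)) = 0"
    by (cases c; simp add: pderiv_pCons)+
  have nat: "pderiv (of_nat m :: complex poly) = 0" by (simp add: of_nat_poly pderiv_pCons)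
  show ?case
  proof (intro exI[of _ "of_nat m * pderiv (pderiv (top_coeff c)) + pderiv (sub_coeff c) + h"] conjI allI)
    show "pderiv (of_nat m * pderiv (pderiv (top_coeff c)) + pderiv (sub_coeff c) + h) = 0"
      by (simp add: pderiv_add pderiv_mult top sub h nat)
    show "(pderiv ^^ Suc m) (act (classical_op c) p) =
      top_coeff c * (pderiv ^^ (Suc m + 2)) p
      + (of_nat (Suc m) * pderiv (top_coeff c) + sub_coeff c) * (pderiv ^^ (Suc m + 1)) p
      + (of_nat m * pderiv (pderiv (top_coeff c)) + pderiv (sub_coeff c) + h) * (pderiv ^^ Suc m) p"
      for p
      by (simp add: eq pderiv_add pderiv_mult h nat) (simp add: algebra_simps)
  qed
qed

text \<open>
  At a zero of \<open>a\<close> (an end point of the interval) the \<open>m\<close>-th derivative of the eigenvalue equation has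
  the coefficient \<open>m a' + b\<close> in front of the highest surviving derivative. It is a multiple of
  \<open>m + \<alpha> + 1\<close> or \<open>m + \<beta> + 1\<close>, so this is where the parameters have to exceed \<open>-1\<close>.
\<close>

lemma top_coeff_nondegenerate:
  assumes "admissible c" "poly (top_coeff c) x = 0"
  shows "poly (of_nat m * pderiv (top_coeff c) + sub_coeff c) x \<noteq> 0"
proof (cases c)
  case (Hermite b)
  then show ?thesis using assms by simp
next
  case (Laguerre \<alpha>)
  have "complex_of_real (real m + \<alpha> + 1) \<noteq> 0"
    using assms(1) Laguerre by (simp only: of_real_eq_0_iff) simp
  then show ?thesis using assms Laguerre by (simp add: pderiv_pCons add.assoc)
next
  case (Jacobi \<alpha> \<beta>)
  have pos: "complex_of_real (real m + \<alpha> + 1) \<noteq> 0" "complex_of_real (real m + \<beta> + 1) \<noteq> 0"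
    using assms(1) Jacobi by (simp_all only: of_real_eq_0_iff) simp_all
  have "x * x = 1" using assms Jacobi by (simp add: algebra_simps)
  then have "x = 1 \<or> x = -1" by (simp add: square_eq_1_iff)
  then show ?thesis
  proof
    assume x: "x = 1"
    have "poly (of_nat m * pderiv (top_coeff c) + sub_coeff c) x = -2 * complex_of_real (real m + \<alpha> + 1)"
      by (simp add: Jacobi x pderiv_pCons algebra_simps)
    then show ?thesis using pos(1) by (metis mult_eq_0_iff neg_equal_0_iff_equal zero_neq_numeral)
  next
    assume x: "x = -1"
    have "poly (of_nat m * pderiv (top_coeff c) + sub_coeff c) x = 2 * complex_of_real (real m + \<beta> + 1)"
      by (simp add: Jacobi x pderiv_pCons algebra_simps)
    then show ?thesis using pos(2) by (metis mult_eq_0_iff zero_neq_numeral)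
  qed
qed

text \<open>
  If \<open>p\<close> and \<open>p'\<close> vanished at \<open>x\<close>, the successive derivatives of the eigenvalue equation would make all
  derivatives vanish there, also at the singular points by the preceding lemma; but the \<open>n\<close>-th one is
  a nonzero constant.
\<close>

lemma eigenpoly_simple_roots:
  assumes c: "admissible c"
  shows "\<not> (poly (eigenpoly c n) x = 0 \<and> poly (pderiv (eigenpoly c n)) x = 0)"
proof
  let ?q = "eigenpoly c n"
  assume *: "poly ?q x = 0 \<and> poly (pderiv ?q) x = 0"
  have "poly ((pderiv ^^ m) ?q) x = 0 \<and> poly ((pderiv ^^ Suc m) ?q) x = 0" for m
  proof (induction m)
    case 0
    then show ?case using * by simp
  next
    case (Suc m)
    obtain h where h: "(pderiv ^^ k) (act (classical_op c) ?q) =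
       top_coeff c * (pderiv ^^ (k + 2)) ?q
       + (of_nat k * pderiv (top_coeff c) + sub_coeff c) * (pderiv ^^ (k + 1)) ?q
       + h k * (pderiv ^^ k) ?q" for k
      using higher_pderiv_act_classical_op[of _ c] by metis
    have ode: "eigval c n * poly ((pderiv ^^ k) ?q) x =
       poly (top_coeff c) x * poly ((pderiv ^^ (k + 2)) ?q) x
       + poly (of_nat k * pderiv (top_coeff c) + sub_coeff c) x * poly ((pderiv ^^ (k + 1)) ?q) x
       + poly (h k) x * poly ((pderiv ^^ k) ?q) x" for k
      using arg_cong[OF h[of k], of "\<lambda>p. poly p x"]
      by (simp add: act_eigenpoly[OF c] higher_pderiv_smult)
    show ?case
    proof (cases "poly (top_coeff c) x = 0")
      case False
      then show ?thesis using ode[of m] Suc by simp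
    next
      case True
      then show ?thesis
        using ode[of "Suc m"] Suc top_coeff_nondegenerate[OF c True, of "Suc m"] by auto
    qed
  qed
  then have "poly ((pderiv ^^ n) ?q) x = 0" by blast
  moreover have "degree ((pderiv ^^ n) ?q) = 0"
    by (simp add: degree_higher_pderiv degree_eigenpoly[OF c])
  then obtain a where a: "(pderiv ^^ n) ?q = [:a:]" by (metis degree_eq_zeroE)
  moreover have "coeff ((pderiv ^^ n) ?q) 0 \<noteq> 0"
    by (simp add: coeff_higher_pderiv coeff_eigenpoly[OF c] flip: pochhammer_fact)
  ultimately show False by simp
qed

lemma eigenpoly_coprime_pderiv:
  assumes c: "admissible c"
  shows "coprime (eigenpoly c n) (pderiv (eigenpoly c n))"
proof (rule coprimeI)
  fix d assume d: "d dvd eigenpoly c n" "d dvd pderiv (eigenpoly c n)"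
  have "d \<noteq> 0" using d(1) eigenpoly_nonzero[OF c] by auto
  have "degree d = 0"
  proof (rule ccontr)
    assume "degree d \<noteq> 0"
    then have "\<not> constant (poly d)" by (simp add: constant_degree)
    then obtain z where "poly d z = 0" using fundamental_theorem_of_algebra by blast
    then have "poly (eigenpoly c n) z = 0" "poly (pderiv (eigenpoly c n)) z = 0"
      using d by (auto elim!: dvdE)
    then show False using eigenpoly_simple_roots[OF c] by blast
  qed
  then show "is_unit d" using \<open>d \<noteq> 0\<close> by (simp add: is_unit_iff_degree)
qed

text \<open>
  A polynomial of degree \<open>n\<close> that is coprime to its derivative can divide \<open>U p'\<close> only by dividing \<open>U\<close>,
  which is too small. This makes the normal form below unique for large \<open>n\<close>.
\<close>

lemma reduced_form_unique:
  assumes c: "admissible c" and "degree U < n"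
    and eq: "U * pderiv (eigenpoly c n) + V * eigenpoly c n = 0"
  shows "U = 0" "V = 0"
proof -
  have "eigenpoly c n dvd U * pderiv (eigenpoly c n)"
    using eq by (metis add_eq_0_iff dvd_minus_iff dvd_triv_right)
  then have "eigenpoly c n dvd U"
    using coprime_dvd_mult_left_iff[OF eigenpoly_coprime_pderiv[OF c]] by blast
  then show "U = 0"
    using dvd_imp_degree_le[of "eigenpoly c n" U] assms(2) degree_eigenpoly[OF c, of n] by fastforce
  then show "V = 0" using eq eigenpoly_nonzero[OF c] by simp
qed

lemma pderiv_poly_const:
  "pderiv (poly U [:t:]) = poly (map_poly pderiv U) [:t:]"
  by (induction U) (simp_all add: map_poly_pCons pderiv_add pderiv_smult)

text \<open>
  The equation \<open>a p'' = \<nu> p - b p'\<close> eliminates one derivative at the price of one factor \<open>a\<close>. What matters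
  is uniformity in \<open>n\<close>: the coefficients are fixed polynomials in \<open>x\<close> and in the eigenvalue \<open>\<nu>\<close>. They
  are encoded as polynomials in \<open>\<nu>\<close> over the polynomials in \<open>x\<close>, and \<open>[:eigval c n:]\<close> substitutes
  a number for \<open>\<nu>\<close>.
\<close>

lemma reduce_higher_pderiv:
  assumes c: "admissible c"
  shows "\<exists>U V. \<forall>n. top_coeff c ^ j * (pderiv ^^ j) (eigenpoly c n) =
     poly U [:eigval c n:] * pderiv (eigenpoly c n) + poly V [:eigval c n:] * eigenpoly c n"
proof (induction j)
  case 0
  show ?case by (intro exI[of _ 0] exI[of _ 1]) simp
next
  case (Suc j)
  let ?a = "top_coeff c" and ?q = "eigenpoly c" and ?e = "\<lambda>n. [:eigval c n:]"
  obtain U V where UV: "\<And>n. ?a ^ j * (pderiv ^^ j) (?q n) = poly U (?e n) * pderiv (?q n) + poly V (?e n) * ?q n"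
    using Suc by blast
  define U' where "U' = Polynomial.smult ?a (map_poly pderiv U) - Polynomial.smult (sub_coeff c) U
    + Polynomial.smult ?a V - Polynomial.smult (of_nat j * pderiv ?a) U"
  define V' where "V' = pCons 0 U + Polynomial.smult ?a (map_poly pderiv V) - Polynomial.smult (of_nat j * pderiv ?a) V"
  have "?a ^ Suc j * (pderiv ^^ Suc j) (?q n) = poly U' (?e n) * pderiv (?q n) + poly V' (?e n) * ?q n" for n
  proof -
    have ode: "?a * pderiv (pderiv (?q n)) = ?e n * ?q n - sub_coeff c * pderiv (?q n)"
      using act_eigenpoly[OF c, of n] by (simp add: act_classical_op algebra_simps)
    have pow: "?a * pderiv (?a ^ j) = of_nat j * pderiv ?a * ?a ^ j"
    proof (cases j)
      case (Suc k)
      show ?thesis unfolding Suc pderiv_power_Suc by (simp add: of_nat_poly algebra_simps)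
    qed simp
    have "?a ^ Suc j * (pderiv ^^ Suc j) (?q n) =
        ?a * pderiv (?a ^ j * (pderiv ^^ j) (?q n)) - (?a * pderiv (?a ^ j)) * (pderiv ^^ j) (?q n)"
      by (simp add: pderiv_mult algebra_simps)
    also have "\<dots> = ?a * pderiv (?a ^ j * (pderiv ^^ j) (?q n))
        - of_nat j * pderiv ?a * (?a ^ j * (pderiv ^^ j) (?q n))"
      by (simp only: pow mult.assoc)
    also have "\<dots> = ?a * (poly (map_poly pderiv U) (?e n) * pderiv (?q n)
          + poly (map_poly pderiv V) (?e n) * ?q n + poly V (?e n) * pderiv (?q n))
        + poly U (?e n) * (?a * pderiv (pderiv (?q n)))
        - of_nat j * pderiv ?a * (poly U (?e n) * pderiv (?q n) + poly V (?e n) * ?q n)"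
      unfolding UV by (simp add: pderiv_add pderiv_mult pderiv_poly_const algebra_simps)
    also have "\<dots> = poly U' (?e n) * pderiv (?q n) + poly V' (?e n) * ?q n"
      unfolding ode U'_def V'_def by (simp only: poly_add poly_diff poly_smult poly_pCons) (simp add: algebra_simps)
    finally show ?thesis .
  qed
  then show ?case by blast
qed

lemma reduce_diffop:
  assumes c: "admissible c"
  shows "\<exists>r U V. \<forall>n. top_coeff c ^ r * act D (eigenpoly c n) =
     poly U [:eigval c n:] * pderiv (eigenpoly c n) + poly V [:eigval c n:] * eigenpoly c n"
proof -
  obtain r f where D: "act D = diffop_fun r f" using act[of D] by blast
  obtain U V where UV: "\<And>j n. top_coeff c ^ j * (pderiv ^^ j) (eigenpoly c n) =
     poly (U j) [:eigval c n:] * pderiv (eigenpoly c n) + poly (V j) [:eigval c n:] * eigenpoly c n"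
    using reduce_higher_pderiv[OF c] by metis
  define g where "g j = top_coeff c ^ (r - j) * f j" for j
  have "top_coeff c ^ r * act D (eigenpoly c n) =
     poly (\<Sum>j\<le>r. Polynomial.smult (g j) (U j)) [:eigval c n:] * pderiv (eigenpoly c n)
     + poly (\<Sum>j\<le>r. Polynomial.smult (g j) (V j)) [:eigval c n:] * eigenpoly c n" for n
  proof -
    have "top_coeff c ^ r * ((pderiv ^^ j) (eigenpoly c n) * f j) =
        g j * (top_coeff c ^ j * (pderiv ^^ j) (eigenpoly c n))" if "j \<le> r" for j
    proof -
      have "top_coeff c ^ r = top_coeff c ^ (r - j) * top_coeff c ^ j"
        using that by (simp flip: power_add)
      then show ?thesis by (simp add: g_def mult.assoc mult.left_commute mult.commute)
    qed
    then have "top_coeff c ^ r * act D (eigenpoly c n) =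
        (\<Sum>j\<le>r. g j * (top_coeff c ^ j * (pderiv ^^ j) (eigenpoly c n)))"
      unfolding D diffop_fun_def sum_distrib_left by (intro sum.cong) auto
    then show ?thesis
      unfolding UV by (simp add: poly_sum sum_distrib_right sum.distrib distrib_left mult.assoc)
  qed
  then show ?thesis by blast
qed

text \<open>
  Substituting a constant for \<open>\<nu>\<close> cannot raise the degree in \<open>x\<close>; this supplies the bound that makes
  \<open>reduced_form_unique\<close> applicable for all large \<open>n\<close>.
\<close>

lemma degree_poly_const_bounded: "\<exists>B. \<forall>t. degree (poly U [:t:]) \<le> B"
proof (induction U)
  case 0
  show ?case by (intro exI[of _ 0]) simp
next
  case (pCons a U)
  then obtain B where B: "\<And>t. degree (poly U [:t:]) \<le> B" by blast
  have "degree (a + [:t:] * poly U [:t:]) \<le> max (degree a) B" for t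
  proof (rule degree_add_le)
    have "degree ([:t:] * poly U [:t:]) \<le> degree [:t:] + degree (poly U [:t:])" by (rule degree_mult_le)
    then show "degree ([:t:] * poly U [:t:]) \<le> max (degree a) B" using B[of t] by simp
  qed simp
  then show ?case by (intro exI[of _ "max (degree a) B"]) simp
qed

lemma poly_vanishes_at_eigvals:
  assumes c: "admissible c" and "\<And>n. n > B \<Longrightarrow> poly U [:eigval c n:] = 0"
  shows "U = 0"
proof (rule ccontr)
  assume "U \<noteq> 0"
  then have "finite {x. poly U x = 0}" by (rule poly_roots_finite)
  moreover have "(\<lambda>n. [:eigval c n:]) ` {B<..} \<subseteq> {x. poly U x = 0}" using assms(2) by auto
  ultimately have "finite ((\<lambda>n. [:eigval c n:]) ` {B<..})" by (rule finite_subset[rotated])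
  then have "finite {B<..}"
    by (rule finite_imageD) (auto intro!: inj_onI dest: eigval_inj[OF c])
  then show False by (simp add: infinite_Ioi)
qed

lemma top_coeff_nonzero: "top_coeff c \<noteq> 0"
  by (cases c) auto

text \<open>
  The normal form of such an operator vanishes at infinitely many eigenvalues, hence identically, so the
  operator kills the small eigenpolynomials as well.
\<close>

lemma diffop_eq_0I:
  assumes c: "admissible c" and "\<And>n. n > B \<Longrightarrow> act D (eigenpoly c n) = 0"
  shows "D = 0"
proof -
  obtain r U V where UV: "\<And>n. top_coeff c ^ r * act D (eigenpoly c n) =
     poly U [:eigval c n:] * pderiv (eigenpoly c n) + poly V [:eigval c n:] * eigenpoly c n"
    using reduce_diffop[OF c] by blast
  obtain B' where B': "\<And>t. degree (poly U [:t:]) \<le> B'" using degree_poly_const_bounded by blast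
  have "poly U [:eigval c n:] = 0 \<and> poly V [:eigval c n:] = 0" if n: "n > max B B'" for n
  proof -
    have "degree (poly U [:eigval c n:]) < n" using B'[of "eigval c n"] n by simp
    moreover have "poly U [:eigval c n:] * pderiv (eigenpoly c n) + poly V [:eigval c n:] * eigenpoly c n = 0"
      using UV[of n] assms(2)[of n] n by simp
    ultimately show ?thesis using reduced_form_unique[OF c] by blast
  qed
  then have "U = 0" "V = 0" using poly_vanishes_at_eigvals[OF c] by blast+
  then have "act D (eigenpoly c n) = 0" for n using UV[of n] top_coeff_nonzero[of c] by simp
  then show ?thesis by (intro diffop_eqI[OF c]) (simp add: act_simps)
qed

definition intertwines :: "classical \<Rightarrow> classical \<Rightarrow> diffop \<Rightarrow> bool" where
  "intertwines c d D \<longleftrightarrow> (\<forall>n. \<exists>a. act D (eigenpoly c n) = Polynomial.smult a (eigenpoly d n))"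

text \<open>
  Scalar counterpart of \<^const>\<open>poly_op\<close>.
\<close>

definition op_poly :: "complex poly \<Rightarrow> diffop \<Rightarrow> diffop" where
  "op_poly p D = (\<Sum>k\<le>degree p. mult_op [:coeff p k:] * D ^ k)"

lemma act_sum: "act (\<Sum>i\<in>A. D i) p = (\<Sum>i\<in>A. act (D i) p)"
  by (induction A rule: infinite_finite_induct) (auto simp: act_simps)

lemma act_power_eigenpoly:
  assumes "admissible c"
  shows "act (classical_op c ^ k) (eigenpoly c n) = Polynomial.smult (eigval c n ^ k) (eigenpoly c n)"
  by (induction k) (auto simp: act_simps act_eigenpoly[OF assms] act_smult_arg mult.commute)

lemma act_op_poly_eigenpoly:
  assumes "admissible c"
  shows "act (op_poly p (classical_op c)) (eigenpoly c n) =
    Polynomial.smult (poly p (eigval c n)) (eigenpoly c n)"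
  by (simp add: op_poly_def act_sum act_simps act_smult_arg act_power_eigenpoly[OF assms]
      poly_altdef smult_sum[symmetric] flip: smult_sum)

text \<open>
  In the normal form of \<open>D\<close> on \<open>p\<^sub>n\<close> the coefficient of \<open>p\<^sub>n'\<close> vanishes for large \<open>n\<close>, and the other one equals
  \<open>\<lambda>\<^sub>n a\<^sup>r\<close>. Reading off one coefficient in \<open>x\<close> shows that \<open>\<lambda>\<^sub>n\<close> is a polynomial in the eigenvalue of the
  classical operator. This is the scalar case \<open>\<D>(w) = \<complex>[\<delta>]\<close>.
\<close>

lemma commutant_classical_op:
  assumes c: "admissible c" and D: "intertwines c c D"
  shows "\<exists>p. D = op_poly p (classical_op c)"
proof -
  obtain lam where lam: "\<And>n. act D (eigenpoly c n) = Polynomial.smult (lam n) (eigenpoly c n)"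
    using D unfolding intertwines_def by metis
  obtain r U V where UV: "\<And>n. top_coeff c ^ r * act D (eigenpoly c n) =
     poly U [:eigval c n:] * pderiv (eigenpoly c n) + poly V [:eigval c n:] * eigenpoly c n"
    using reduce_diffop[OF c] by blast
  obtain B where B: "\<And>t. degree (poly U [:t:]) \<le> B" using degree_poly_const_bounded by blast
  have V: "poly V [:eigval c n:] = Polynomial.smult (lam n) (top_coeff c ^ r)" if n: "n > B" for n
  proof -
    have "degree (poly U [:eigval c n:]) < n" using B[of "eigval c n"] n by simp
    moreover have "poly U [:eigval c n:] * pderiv (eigenpoly c n)
        + (poly V [:eigval c n:] - Polynomial.smult (lam n) (top_coeff c ^ r)) * eigenpoly c n = 0"
      using UV[of n] by (simp add: lam algebra_simps)
    ultimately show ?thesis using reduced_form_unique(2)[OF c] by fastforce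
  qed
  \<comment> \<open>Any nonzero coefficient of \<open>a\<^sup>r\<close> lets \<open>\<lambda>\<^sub>n\<close> be solved for.\<close>
  obtain i where i: "coeff (top_coeff c ^ r) i \<noteq> 0"
    using top_coeff_nonzero[of c] by (metis leading_coeff_0_iff power_not_zero)
  define p where "p = Polynomial.smult (inverse (coeff (top_coeff c ^ r) i)) (map_poly (\<lambda>q. coeff q i) V)"
  have coeff_poly: "coeff (poly W [:t:]) i = poly (map_poly (\<lambda>q. coeff q i) W) t" for W t
    by (induction W) (simp_all add: map_poly_pCons)
  have p: "poly p (eigval c n) = lam n" if "n > B" for n
    using arg_cong[OF V[OF that], of "\<lambda>q. coeff q i"] i by (simp add: coeff_poly p_def)
  have "D - op_poly p (classical_op c) = 0"
    by (rule diffop_eq_0I[OF c, of B]) (simp add: act_minus lam act_op_poly_eigenpoly[OF c] p)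
  then show ?thesis by auto
qed

section \<open>Intertwiners between two classical weights\<close>

text \<open>
  As a polynomial in \<open>n\<close> the Jacobi eigenvalue has degree 2. A polynomial in it therefore has even degree
  in \<open>n\<close>, while \<open>n\<close> times such a polynomial has odd degree, so the two agree for large \<open>n\<close> only if both
  vanish.
\<close>

lemma eigval_parity:
  assumes eq: "\<And>n. n > m \<Longrightarrow> poly A [:eigval (Jacobi \<alpha> \<beta>) n:] =
      Polynomial.smult (of_nat n) (poly B [:eigval (Jacobi \<alpha> \<beta>) n:])"
  shows "B = 0"
proof (rule ccontr)
  assume B: "B \<noteq> 0"
  \<comment> \<open>\<open>M\<close> is the eigenvalue as a polynomial in \<open>n\<close>, with constant coefficients in \<open>x\<close>.\<close>
  define M :: "complex poly poly" where "M = [:0, [:- (of_real \<alpha> + of_real \<beta> + 1):], -1:]"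
  have M: "poly M [:of_nat n:] = [:eigval (Jacobi \<alpha> \<beta>) n:]" for n
    by (simp add: M_def one_pCons algebra_simps)
  have deg: "degree (pcompose P M) = 2 * degree P" for P
    by (simp add: degree_pcompose M_def)
  define F where "F = pcompose A M - pCons 0 (pcompose B M)"
  have "poly F [:of_nat n:] = 0" if "n > m" for n
    using eq[OF that] by (simp add: F_def poly_pcompose M)
  then have "(\<lambda>n. [:of_nat n:]) ` {m<..} \<subseteq> {x. poly F x = 0}" by auto
  moreover have "infinite ((\<lambda>n. [:of_nat n :: complex:]) ` {m<..})"
    by (auto dest!: finite_imageD intro!: inj_onI simp: infinite_Ioi)
  ultimately have "F = 0" using poly_roots_finite finite_subset by blast
  then have "pcompose A M = pCons 0 (pcompose B M)" by (simp add: F_def)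
  moreover have "pcompose B M \<noteq> 0"
    using B by (auto simp: M_def dest: pcompose_eq_0)
  ultimately have "2 * degree A = Suc (2 * degree B)"
    by (metis deg degree_pCons_eq)
  then show False by presburger
qed

text \<open>
  The difference of the two eigenvalues is \<open>n t\<close> with \<open>t = (\<alpha>' + \<beta>') - (\<alpha> + \<beta>)\<close>. If \<open>t\<close> is nonzero, then
  \<open>N = \<delta> D - D \<delta>'\<close> acts on \<open>p\<^sub>n\<close> as \<open>n t D\<close>. Comparing the normal forms of \<open>N\<close> and \<open>D\<close>, whose coefficients
  are polynomials in the eigenvalue, contradicts the parity in \<open>n\<close> unless \<open>D = 0\<close>.
\<close>

lemma intertwines_Jacobi_sum:
  assumes c: "admissible (Jacobi \<alpha> \<beta>)" and d: "admissible (Jacobi \<alpha>' \<beta>')"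
    and D: "intertwines (Jacobi \<alpha> \<beta>) (Jacobi \<alpha>' \<beta>') D" "D \<noteq> 0"
  shows "\<alpha> + \<beta> = \<alpha>' + \<beta>'"
proof (rule ccontr)
  assume neq: "\<alpha> + \<beta> \<noteq> \<alpha>' + \<beta>'"
  let ?c = "Jacobi \<alpha> \<beta>" and ?d = "Jacobi \<alpha>' \<beta>'"
  define t where "t = complex_of_real (\<alpha>' + \<beta>' - \<alpha> - \<beta>)"
  have t: "t \<noteq> 0" using neq unfolding t_def of_real_eq_0_iff by simp
  define N where "N = classical_op ?c * D - D * classical_op ?d"
  have N: "act N (eigenpoly ?c n) = Polynomial.smult (of_nat n * t) (act D (eigenpoly ?c n))" for n
  proof -
    obtain a where a: "act D (eigenpoly ?c n) = Polynomial.smult a (eigenpoly ?d n)"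
      using D(1) unfolding intertwines_def by blast
    have "act N (eigenpoly ?c n) = Polynomial.smult ((eigval ?c n - eigval ?d n) * a) (eigenpoly ?d n)"
      unfolding N_def act_minus times_diffop.rep_eq
      by (simp add: act_eigenpoly[OF c] act_eigenpoly[OF d] act_smult_arg a smult_diff_left[symmetric]
          algebra_simps del: eigval.simps classical_op.simps)
    moreover have "eigval ?c n - eigval ?d n = of_nat n * t"
      by (simp add: t_def algebra_simps)
    ultimately show ?thesis by (simp add: a)
  qed
  obtain r U V where D_red: "\<And>n. top_coeff ?c ^ r * act D (eigenpoly ?c n) =
     poly U [:eigval ?c n:] * pderiv (eigenpoly ?c n) + poly V [:eigval ?c n:] * eigenpoly ?c n"
    using reduce_diffop[OF c] by blast
  obtain r' U' V' where N_red: "\<And>n. top_coeff ?c ^ r' * act N (eigenpoly ?c n) =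
     poly U' [:eigval ?c n:] * pderiv (eigenpoly ?c n) + poly V' [:eigval ?c n:] * eigenpoly ?c n"
    using reduce_diffop[OF c] by blast
  \<comment> \<open>The normal forms may carry different powers of \<open>a\<close>; multiplying crosswise makes them comparable.\<close>
  define A1 A2 where "A1 = Polynomial.smult (top_coeff ?c ^ r) U'" and "A2 = Polynomial.smult (top_coeff ?c ^ r) V'"
  define B1 B2 where "B1 = Polynomial.smult ([:t:] * top_coeff ?c ^ r') U"
    and "B2 = Polynomial.smult ([:t:] * top_coeff ?c ^ r') V"
  have diff: "(poly A1 [:eigval ?c n:] - Polynomial.smult (of_nat n) (poly B1 [:eigval ?c n:])) * pderiv (eigenpoly ?c n)
     + (poly A2 [:eigval ?c n:] - Polynomial.smult (of_nat n) (poly B2 [:eigval ?c n:])) * eigenpoly ?c n = 0" for n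
  proof -
    let ?e = "[:eigval ?c n:]" and ?q = "eigenpoly ?c n" and ?a = "top_coeff ?c"
    have "?a ^ r * (?a ^ r' * act N ?q) = ?a ^ r' * Polynomial.smult (of_nat n * t) (?a ^ r * act D ?q)"
      by (simp add: N mult.left_commute)
    then have "?a ^ r * (poly U' ?e * pderiv ?q + poly V' ?e * ?q) =
        ?a ^ r' * Polynomial.smult (of_nat n * t) (poly U ?e * pderiv ?q + poly V ?e * ?q)"
      unfolding N_red D_red .
    then show ?thesis
      by (simp add: A1_def A2_def B1_def B2_def algebra_simps smult_add_right smult_diff_right del: eigval.simps top_coeff.simps)
  qed
  obtain m1 where m1: "\<And>s. degree (poly A1 [:s:]) \<le> m1" using degree_poly_const_bounded by blast
  obtain m2 where m2: "\<And>s. degree (poly B1 [:s:]) \<le> m2" using degree_poly_const_bounded by blast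
  have "poly A1 [:eigval ?c n:] = Polynomial.smult (of_nat n) (poly B1 [:eigval ?c n:]) \<and>
      poly A2 [:eigval ?c n:] = Polynomial.smult (of_nat n) (poly B2 [:eigval ?c n:])"
    if n: "n > max m1 m2" for n
  proof -
    have "degree (poly A1 [:eigval ?c n:] - Polynomial.smult (of_nat n) (poly B1 [:eigval ?c n:])) < n"
      using m1[of "eigval ?c n"] m2[of "eigval ?c n"] n degree_smult_le[of "of_nat n" "poly B1 [:eigval ?c n:]"]
      by (intro le_less_trans[OF degree_diff_le_max]) (auto simp del: eigval.simps)
    from reduced_form_unique[OF c this diff] show ?thesis by (simp del: eigval.simps)
  qed
  then have "B1 = 0" "B2 = 0" using eigval_parity by blast+
  then have "U = 0" "V = 0" using t top_coeff_nonzero[of ?c] by (auto simp: B1_def B2_def)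
  then have "act D (eigenpoly ?c n) = 0" for n
    using D_red[of n] top_coeff_nonzero[of ?c] by (simp del: top_coeff.simps)
  then have "D = 0" by (intro diffop_eqI[OF c]) (simp add: act_simps)
  then show False using D(2) by simp
qed

lemma same_type_pair_cases:
  assumes "same_type {c, d}"
  obtains (Hermite) a b where "c = Hermite a" "d = Hermite b"
    | (Laguerre) \<alpha> \<beta> where "c = Laguerre \<alpha>" "d = Laguerre \<beta>"
    | (Jacobi) \<alpha> \<beta> \<alpha>' \<beta>' where "c = Jacobi \<alpha> \<beta>" "d = Jacobi \<alpha>' \<beta>'"
  using assms by (cases c; cases d) (auto simp: same_type_def)

lemma intertwiner_eigval:
  assumes "admissible c" "admissible d" "same_type {c, d}" "intertwines c d D" "D \<noteq> 0"
  shows "eigval c n = eigval d n"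
  using assms(3)
proof (cases rule: same_type_pair_cases)
  case (Jacobi \<alpha> \<beta> \<alpha>' \<beta>')
  then have "\<alpha> + \<beta> = \<alpha>' + \<beta>'" using intertwines_Jacobi_sum assms by metis
  then have "complex_of_real \<alpha> + complex_of_real \<beta> = complex_of_real \<alpha>' + complex_of_real \<beta>'"
    by (metis of_real_add)
  then show ?thesis using Jacobi by (simp add: add.assoc)
qed simp_all

lemma intertwiner_commutes:
  assumes c: "admissible c" and d: "admissible d" and "same_type {c, d}"
    and D: "intertwines c d D" "D \<noteq> 0"
  shows "classical_op c * D = D * classical_op d"
proof (rule diffop_eqI[OF c])
  fix n
  obtain a where a: "act D (eigenpoly c n) = Polynomial.smult a (eigenpoly d n)"
    using D(1) unfolding intertwines_def by blast
  show "act (classical_op c * D) (eigenpoly c n) = act (D * classical_op d) (eigenpoly c n)"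
    using intertwiner_eigval[OF assms]
    by (simp add: act_simps act_eigenpoly[OF c] act_eigenpoly[OF d] act_smult_arg a mult.commute)
qed

lemma higher_pderiv_linear_power:
  fixes z :: "'a :: field_char_0"
  shows "j \<le> m \<Longrightarrow> (pderiv ^^ j) ([:- z, 1:] ^ m) =
     Polynomial.smult (fact m / fact (m - j)) ([:- z, 1:] ^ (m - j))"
proof (induction j)
  case (Suc j)
  define k where "k = m - Suc j"
  have k: "m - j = Suc k" "m - Suc j = k" using Suc.prems by (simp_all add: k_def)
  have "pderiv ([:- z, 1:] ^ Suc k) = Polynomial.smult (of_nat (Suc k)) ([:- z, 1:] ^ k)"
    by (simp only: pderiv_power_Suc) (simp add: pderiv_pCons)
  then have "(pderiv ^^ Suc j) ([:- z, 1:] ^ m) =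
      Polynomial.smult (fact m / fact (Suc k)) (Polynomial.smult (of_nat (Suc k)) ([:- z, 1:] ^ k))"
    using Suc unfolding k by (simp add: pderiv_smult del: power_Suc fact_Suc of_nat_Suc)
  also have "\<dots> = Polynomial.smult (fact m / fact (m - Suc j)) ([:- z, 1:] ^ (m - Suc j))"
    unfolding k by (simp add: field_simps del: of_nat_Suc)
  finally show ?case .
qed simp

lemma poly_higher_pderiv_linear_power:
  fixes z :: "'a :: field_char_0"
  assumes "j \<le> m"
  shows "poly ((pderiv ^^ j) ([:- z, 1:] ^ m)) z = (if j = m then fact m else 0)"
  using assms by (simp add: higher_pderiv_linear_power)

text \<open>
  Operators are given by their action, so the order and the leading coefficient have to be recovered from
  some representation by trimming its zero coefficients.
\<close>

lemma diffop_leading_coeff: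
  assumes "D \<noteq> 0"
  obtains r f where "\<And>p. act D p = (\<Sum>j\<le>r. (pderiv ^^ j) p * f j)" "f r \<noteq> 0"
proof -
  obtain m f where D: "act D = diffop_fun m f" using act[of D] by blast
  define S where "S = {j. j \<le> m \<and> f j \<noteq> 0}"
  have "S \<noteq> {}"
  proof
    assume "S = {}"
    then have "act D p = act 0 p" for p by (auto simp: D diffop_fun_def act_simps S_def)
    then show False using assms by (metis act_inject ext)
  qed
  define r where "r = Max S"
  have fin: "finite S" by (simp add: S_def)
  have r: "r \<in> S" unfolding r_def using fin \<open>S \<noteq> {}\<close> by (rule Max_in)
  have "f j = 0" if "j \<le> m" "r < j" for j
    using that Max_ge[OF fin, of j] unfolding r_def by (metis (mono_tags, lifting) S_def leD mem_Collect_eq)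
  then have "act D p = (\<Sum>j\<le>r. (pderiv ^^ j) p * f j)" for p
    unfolding D diffop_fun_def using r by (intro sum.mono_neutral_right) (auto simp: S_def)
  then show thesis using r that by (auto simp: S_def)
qed

text \<open>
  In \<open>\<delta> D = D \<delta>'\<close> the terms of order \<open>r + 2\<close> cancel because both operators have the same \<open>a\<close>. The terms
  of order \<open>r + 1\<close> involve only the leading coefficient of \<open>D\<close> and give a first-order equation for it.
\<close>

lemma intertwiner_symbol_equation:
  assumes top: "top_coeff c = top_coeff d"
    and comm: "classical_op c * D = D * classical_op d"
    and D: "\<And>p. act D p = (\<Sum>j\<le>r. (pderiv ^^ j) p * f j)"
  shows "2 * top_coeff c * pderiv (f r)
     + (sub_coeff d - sub_coeff c - of_nat r * pderiv (top_coeff c)) * f r = 0"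
proof -
  obtain h where h: "(pderiv ^^ j) (act (classical_op c) p) =
       top_coeff c * (pderiv ^^ (j + 2)) p
       + (of_nat j * pderiv (top_coeff c) + sub_coeff c) * (pderiv ^^ (j + 1)) p
       + h j * (pderiv ^^ j) p" for j p
    using higher_pderiv_act_classical_op[of _ c] by metis
  define g where "g j = 2 * top_coeff c * pderiv (f j)
     + (sub_coeff d - sub_coeff c - of_nat j * pderiv (top_coeff c)) * f j" for j
  define k where "k j = top_coeff c * pderiv (pderiv (f j)) + sub_coeff d * pderiv (f j) - h j * f j" for j
  have eq: "(\<Sum>j\<le>r. g j * (pderiv ^^ (j + 1)) p + k j * (pderiv ^^ j) p) = 0" for p
  proof -
    have "act (classical_op d) (act D p) = (\<Sum>j\<le>r. top_coeff c * pderiv (pderiv ((pderiv ^^ j) p * f j))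
        + sub_coeff d * pderiv ((pderiv ^^ j) p * f j))"
      unfolding act_classical_op D top[symmetric] by (simp add: pderiv_sum sum_distrib_left sum.distrib)
    moreover have "act D (act (classical_op c) p) = (\<Sum>j\<le>r. (top_coeff c * (pderiv ^^ (j + 2)) p
       + (of_nat j * pderiv (top_coeff c) + sub_coeff c) * (pderiv ^^ (j + 1)) p
       + h j * (pderiv ^^ j) p) * f j)"
      unfolding D h ..
    moreover have "act (classical_op d) (act D p) = act D (act (classical_op c) p)"
      using arg_cong[OF comm, of "\<lambda>E. act E p"] by (simp add: act_simps)
    ultimately have "0 = (\<Sum>j\<le>r. (top_coeff c * pderiv (pderiv ((pderiv ^^ j) p * f j))
        + sub_coeff d * pderiv ((pderiv ^^ j) p * f j)) - (top_coeff c * (pderiv ^^ (j + 2)) p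
       + (of_nat j * pderiv (top_coeff c) + sub_coeff c) * (pderiv ^^ (j + 1)) p
       + h j * (pderiv ^^ j) p) * f j)"
      by (simp add: sum_subtractf)
    also have "\<dots> = (\<Sum>j\<le>r. g j * (pderiv ^^ (j + 1)) p + k j * (pderiv ^^ j) p)"
    proof (intro sum.cong refl)
      fix j
      define P where "P = (pderiv ^^ j) p"
      have "(pderiv ^^ (j + 2)) p = pderiv (pderiv P)" "(pderiv ^^ (j + 1)) p = pderiv P"
        by (simp_all add: P_def numeral_2_eq_2)
      then show "(top_coeff c * pderiv (pderiv ((pderiv ^^ j) p * f j))
        + sub_coeff d * pderiv ((pderiv ^^ j) p * f j)) - (top_coeff c * (pderiv ^^ (j + 2)) p
         + (of_nat j * pderiv (top_coeff c) + sub_coeff c) * (pderiv ^^ (j + 1)) p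
         + h j * (pderiv ^^ j) p) * f j = g j * (pderiv ^^ (j + 1)) p + k j * (pderiv ^^ j) p"
        unfolding P_def[symmetric] g_def k_def
        by (simp only: pderiv_mult pderiv_add mult_2 mult_2_right) (simp only: algebra_simps)
    qed
    finally show ?thesis by simp
  qed
  have "poly (g r) z = 0" for z
  proof -
    \<comment> \<open>At \<open>z\<close>, the only derivative of \<open>(x - z)\<^sup>r\<^sup>+\<^sup>1\<close> of order at most \<open>r + 1\<close> that survives is the last.\<close>
    define p where "p = [:- z, 1:] ^ (r + 1)"
    have p: "poly ((pderiv ^^ (j + 1)) p) z = (if j = r then fact (r + 1) else 0)"
      "poly ((pderiv ^^ j) p) z = 0" if "j \<le> r" for j
      using that poly_higher_pderiv_linear_power[of "j + 1" "r + 1" z]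
        poly_higher_pderiv_linear_power[of j "r + 1" z] unfolding p_def by auto
    have "0 = (\<Sum>j\<le>r. poly (g j) z * poly ((pderiv ^^ (j + 1)) p) z + poly (k j) z * poly ((pderiv ^^ j) p) z)"
      using arg_cong[OF eq[of p], of "\<lambda>q. poly q z"] by (simp only: poly_sum poly_add poly_mult poly_0)
    also have "\<dots> = (\<Sum>j\<le>r. if j = r then poly (g r) z * fact (r + 1) else 0)"
      by (intro sum.cong refl) (simp only: p atMost_iff, simp)
    also have "\<dots> = poly (g r) z * fact (r + 1)" by simp
    finally show ?thesis by (simp del: fact_Suc)
  qed
  then have "g r = 0" using poly_all_0_iff_0 by blast
  then show ?thesis by (simp add: g_def)
qed

text \<open>
  The explicit form that Darboux equivalence takes on the parameters; see \<open>darboux_iff_integer_shift\<close>.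
\<close>

fun integer_shift :: "classical \<Rightarrow> classical \<Rightarrow> bool" where
  "integer_shift (Hermite a) (Hermite b) \<longleftrightarrow> a = b"
| "integer_shift (Laguerre \<alpha>) (Laguerre \<alpha>') \<longleftrightarrow> \<alpha>' - \<alpha> \<in> \<int>"
| "integer_shift (Jacobi \<alpha> \<beta>) (Jacobi \<alpha>' \<beta>') \<longleftrightarrow> \<alpha> + \<beta> = \<alpha>' + \<beta>' \<and> \<alpha>' - \<alpha> \<in> \<int>"
| "integer_shift _ _ \<longleftrightarrow> False"

text \<open>
  The equation for the leading coefficient \<open>f\<close> has a nonzero polynomial solution only for special
  parameters. In the Hermite case \<open>2 f' + const f = 0\<close> forces the constant to vanish. In the Laguerre case
  the coefficient at the degree of \<open>f\<close>, and in the Jacobi case the order of \<open>f\<close> at \<open>1\<close>, expresses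
  \<open>\<alpha>' - \<alpha>\<close> as \<open>r\<close> minus an even integer.
\<close>

lemma intertwiner_integer_shift:
  assumes c: "admissible c" and d: "admissible d" and st: "same_type {c, d}"
    and D: "intertwines c d D" "D \<noteq> 0"
  shows "integer_shift c d"
proof -
  obtain r f where rf: "\<And>p. act D p = (\<Sum>j\<le>r. (pderiv ^^ j) p * f j)" "f r \<noteq> 0"
    using diffop_leading_coeff[OF D(2)] by metis
  have "top_coeff c = top_coeff d" using st by (cases rule: same_type_pair_cases) auto
  from intertwiner_symbol_equation[OF this intertwiner_commutes[OF c d st D] rf(1)]
  have symb: "2 * top_coeff c * pderiv (f r)
     + (sub_coeff d - sub_coeff c - of_nat r * pderiv (top_coeff c)) * f r = 0" .
  define n where "n = degree (f r)"
  have lead: "coeff (f r) n \<noteq> 0" "coeff (f r) (Suc n) = 0"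
    using rf(2) by (simp_all add: n_def coeff_eq_0)
  show ?thesis
    using st
  proof (cases rule: same_type_pair_cases)
    case (Hermite a b)
    have "Polynomial.smult 2 (pderiv (f r)) + Polynomial.smult (2 * of_real b - 2 * of_real a) (f r) = 0"
      using symb by (simp add: Hermite numeral_poly)
    from arg_cong[OF this, of "\<lambda>p. coeff p n"] lead show ?thesis
      by (simp add: Hermite coeff_pderiv)
  next
    case (Laguerre \<alpha> \<alpha>')
    have "pCons 0 (Polynomial.smult 2 (pderiv (f r))) + Polynomial.smult (of_real \<alpha>' - of_real \<alpha> - of_nat r) (f r) = 0"
      using symb by (simp add: Laguerre numeral_poly of_nat_poly pderiv_pCons smult_diff_left)
    moreover have "coeff (pCons 0 (Polynomial.smult 2 (pderiv (f r)))) n = 2 * of_nat n * coeff (f r) n"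
      by (cases n) (simp_all add: coeff_pderiv)
    ultimately have "(2 * of_nat n + (of_real \<alpha>' - of_real \<alpha> - of_nat r)) * coeff (f r) n = 0"
      by (metis (no_types, lifting) coeff_0 coeff_add coeff_smult distrib_right)
    then have "2 * of_nat n + (complex_of_real \<alpha>' - of_real \<alpha> - of_nat r) = 0"
      using lead(1) mult_eq_0_iff by blast
    then have "complex_of_real (\<alpha>' - \<alpha>) = complex_of_real (real r - 2 * real n)"
      by (simp add: algebra_simps)
    then have "\<alpha>' - \<alpha> = real r - 2 * real n" using of_real_eq_iff by blast
    then show ?thesis by (simp add: Laguerre)
  next
    case (Jacobi \<alpha> \<beta> \<alpha>' \<beta>')
    have sum: "\<alpha> + \<beta> = \<alpha>' + \<beta>'" using intertwines_Jacobi_sum c d D Jacobi by metis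
    define L :: "complex poly" where "L = [:-1, 1:]"
    have L: "pderiv L = 1" "poly L 1 = 0" "L \<noteq> 0" by (simp_all add: L_def pderiv_pCons)
    define k where "k = Polynomial.order 1 (f r)"
    obtain g where g: "f r = L ^ k * g" and g1: "poly g 1 \<noteq> 0"
      using order_decomp[OF rf(2), of 1] by (auto simp: k_def L_def dvd_iff_poly_eq_0)
    have pd: "L * pderiv (f r) = L ^ k * (of_nat k * g + L * pderiv g)"
    proof (cases k)
      case (Suc m)
      have "pderiv (L ^ k) = of_nat k * L ^ m"
        unfolding Suc by (simp only: pderiv_power_Suc L) (simp add: of_nat_poly)
      then show ?thesis unfolding g pderiv_mult by (simp add: Suc algebra_simps)
    qed (simp add: g)
    define S where "S = sub_coeff d - sub_coeff c - of_nat r * pderiv (top_coeff c)"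
    define R where "R = of_nat k * g + L * pderiv g"
    have "top_coeff c = - [:1, 1:] * L" by (simp add: Jacobi L_def)
    then have "0 = - 2 * [:1, 1:] * (L * pderiv (f r)) + S * f r"
      using symb unfolding S_def[symmetric] by (simp only: mult.assoc mult_minus_left mult_minus_right)
    also have "\<dots> = L ^ k * (- 2 * [:1, 1:] * R + S * g)"
      unfolding pd R_def[symmetric] unfolding g by (simp only: algebra_simps)
    finally have "- 2 * [:1, 1:] * R + S * g = 0" using L(3) by simp
    from arg_cong[OF this, of "\<lambda>p. poly p 1"]
    have "(- 4 * of_nat k + (2 * of_real \<alpha> - 2 * of_real \<alpha>' + 2 * of_nat r)) * poly g 1 = 0"
    proof -
      have "complex_of_real \<beta>' = of_real \<alpha> + of_real \<beta> - of_real \<alpha>'"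
        using sum by (metis add_diff_cancel_left' of_real_add of_real_diff)
      then have "poly S 1 = 2 * of_real \<alpha> - 2 * of_real \<alpha>' + 2 * of_nat r"
        by (simp add: S_def Jacobi pderiv_pCons)
      moreover have "poly R 1 = of_nat k * poly g 1" by (simp add: R_def L)
      moreover have "poly (- 2 * [:1, 1:] * R + S * g) 1 = - 4 * poly R 1 + poly S 1 * poly g 1"
        by simp
      ultimately have "- 4 * (of_nat k * poly g 1)
          + (2 * of_real \<alpha> - 2 * of_real \<alpha>' + 2 * of_nat r) * poly g 1 = 0"
        using \<open>poly (- 2 * [:1, 1:] * R + S * g) 1 = poly 0 1\<close> by (metis poly_0)
      then show ?thesis by (simp only: distrib_right mult.assoc)
    qed
    then have "- 4 * of_nat k + (2 * complex_of_real \<alpha> - 2 * of_real \<alpha>' + 2 * of_nat r) = 0"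
      using g1 mult_eq_0_iff by blast
    then have "2 * complex_of_real (\<alpha>' - \<alpha>) = 2 * complex_of_real (real r - 2 * real k)"
      by (simp add: algebra_simps)
    then have "complex_of_real (\<alpha>' - \<alpha>) = complex_of_real (real r - 2 * real k)"
      by (simp only: mult_cancel_left) simp
    then have "\<alpha>' - \<alpha> = real r - 2 * real k" using of_real_eq_iff by blast
    then show ?thesis using sum by (simp add: Jacobi)
  qed
qed

section \<open>Ladder operators\<close>

text \<open>
  The operators that may serve as left factors \<open>V\<close> in a Darboux transformation from \<open>c\<close> to \<open>d\<close>.
\<close>

definition darboux_map :: "classical \<Rightarrow> classical \<Rightarrow> diffop \<Rightarrow> bool" where
  "darboux_map c d V \<longleftrightarrow> degree_preserving V \<and> intertwines c d V"

lemma darboux_map_one: "darboux_map c c 1"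
  unfolding darboux_map_def degree_preserving_def intertwines_def
  by (auto simp: act_simps intro: exI[of _ 1])

lemma darboux_map_mult:
  assumes V: "darboux_map c d V" and W: "darboux_map d e W"
  shows "darboux_map c e (V * W)"
proof -
  have "\<exists>a. act (V * W) (eigenpoly c n) = Polynomial.smult a (eigenpoly e n)" for n
  proof -
    obtain a where "act V (eigenpoly c n) = Polynomial.smult a (eigenpoly d n)"
      using V unfolding darboux_map_def intertwines_def by blast
    moreover obtain b where "act W (eigenpoly d n) = Polynomial.smult b (eigenpoly e n)"
      using W unfolding darboux_map_def intertwines_def by blast
    ultimately have "act (V * W) (eigenpoly c n) = Polynomial.smult (a * b) (eigenpoly e n)"
      by (simp add: act_simps act_smult_arg)
    then show ?thesis by blast
  qed
  then show ?thesis
    using V W by (auto simp: darboux_map_def degree_preserving_def intertwines_def act_simps)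
qed

text \<open>
  An operator with \<open>\<delta> V = V \<delta>'\<close> maps eigenpolynomials to eigenpolynomials with the same eigenvalue, which
  are unique up to scaling.
\<close>

lemma intertwinesI:
  assumes "admissible c" "admissible d" "\<And>n. eigval c n = eigval d n"
    and comm: "\<And>p. act (classical_op d) (act V p) = act V (act (classical_op c) p)"
  shows "intertwines c d V"
  unfolding intertwines_def
  using eigenpoly_unique[OF assms(2)] by (simp add: comm act_eigenpoly assms act_smult_arg)

definition first_order_op :: "complex \<Rightarrow> complex \<Rightarrow> complex \<Rightarrow> diffop" where
  "first_order_op u v g = deriv_op * mult_op [:u, v:] + mult_op [:g:]"

lemma act_first_order_op: "act (first_order_op u v g) p = [:u, v:] * pderiv p + [:g:] * p"
  by (simp add: first_order_op_def act_simps mult.commute)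

text \<open>
  The coefficient \<open>v n + g\<close> is the factor by which the leading coefficient of a polynomial of degree \<open>n\<close>
  is multiplied.
\<close>

lemma degree_preserving_first_order_op:
  assumes "\<And>n. v * of_nat n + g \<noteq> 0"
  shows "degree_preserving (first_order_op u v g)"
  unfolding degree_preserving_def
proof (intro allI impI)
  fix p :: "complex poly" assume "p \<noteq> 0"
  have cf: "coeff (act (first_order_op u v g) p) n =
      u * of_nat (Suc n) * coeff p (Suc n) + (v * of_nat n + g) * coeff p n" for n
    by (cases n) (simp_all add: act_first_order_op coeff_pderiv algebra_simps)
  have "coeff (act (first_order_op u v g) p) (degree p) \<noteq> 0"
    using assms \<open>p \<noteq> 0\<close> by (simp add: cf coeff_eq_0)
  moreover have "degree (act (first_order_op u v g) p) \<le> degree p"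
    by (intro degree_le) (simp add: cf coeff_eq_0)
  ultimately show "act (first_order_op u v g) p \<noteq> 0 \<and> degree (act (first_order_op u v g) p) = degree p"
    by (metis antisym coeff_0 le_degree)
qed

text \<open>
  These four ladder operators are the contiguous relations of the Laguerre and Jacobi polynomials that do
  not involve \<open>n\<close>: for instance \<open>L\<^sub>n - L\<^sub>n'\<close> is the Laguerre polynomial with \<open>\<alpha>\<close> raised by one. Each
  intertwines the two second-order operators and, within the stated bounds, preserves degrees.
\<close>

lemma darboux_map_Laguerre_up:
  assumes "\<alpha> > -1"
  shows "darboux_map (Laguerre \<alpha>) (Laguerre (\<alpha> + 1)) (first_order_op (-1) 0 1)"
  unfolding darboux_map_def
proof
  show "intertwines (Laguerre \<alpha>) (Laguerre (\<alpha> + 1)) (first_order_op (-1) 0 1)"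
  proof (rule intertwinesI)
    show "act (classical_op (Laguerre (\<alpha> + 1))) (act (first_order_op (-1) 0 1) p) =
        act (first_order_op (-1) 0 1) (act (classical_op (Laguerre \<alpha>)) p)" for p
      unfolding act_classical_op act_first_order_op
      by (rule poly_ext) (simp add: pderiv_add pderiv_mult pderiv_pCons pderiv_smult pderiv_minus pderiv_diff, simp add: algebra_simps)
  qed (use assms in auto)
qed (rule degree_preserving_first_order_op, simp)

lemma darboux_map_Laguerre_down:
  assumes "\<alpha> > -1"
  shows "darboux_map (Laguerre (\<alpha> + 1)) (Laguerre \<alpha>) (first_order_op 0 1 (of_real \<alpha> + 1))"
  unfolding darboux_map_def
proof
  show "degree_preserving (first_order_op 0 1 (of_real \<alpha> + 1))"
  proof (rule degree_preserving_first_order_op)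
    fix n
    have "complex_of_real (real n + \<alpha> + 1) \<noteq> 0"
      using assms unfolding of_real_eq_0_iff by simp
    then show "1 * complex_of_nat n + (of_real \<alpha> + 1) \<noteq> 0" by (simp add: add.assoc)
  qed
  show "intertwines (Laguerre (\<alpha> + 1)) (Laguerre \<alpha>) (first_order_op 0 1 (of_real \<alpha> + 1))"
  proof (rule intertwinesI)
    show "act (classical_op (Laguerre \<alpha>)) (act (first_order_op 0 1 (of_real \<alpha> + 1)) p) =
        act (first_order_op 0 1 (of_real \<alpha> + 1)) (act (classical_op (Laguerre (\<alpha> + 1))) p)" for p
      unfolding act_classical_op act_first_order_op
      by (rule poly_ext) (simp add: pderiv_add pderiv_mult pderiv_pCons pderiv_smult pderiv_minus pderiv_diff, simp add: algebra_simps)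
  qed (use assms in auto)
qed

lemma darboux_map_Jacobi_up:
  assumes "\<alpha> > -1" "\<beta> > 0"
  shows "darboux_map (Jacobi \<alpha> \<beta>) (Jacobi (\<alpha> + 1) (\<beta> - 1)) (first_order_op 1 1 (of_real \<beta>))"
  unfolding darboux_map_def
proof
  show "degree_preserving (first_order_op 1 1 (of_real \<beta>))"
  proof (rule degree_preserving_first_order_op)
    fix n
    have "complex_of_real (real n + \<beta>) \<noteq> 0"
      using assms unfolding of_real_eq_0_iff by simp
    then show "1 * complex_of_nat n + of_real \<beta> \<noteq> 0" by simp
  qed
  show "intertwines (Jacobi \<alpha> \<beta>) (Jacobi (\<alpha> + 1) (\<beta> - 1)) (first_order_op 1 1 (of_real \<beta>))"
  proof (rule intertwinesI)
    show "act (classical_op (Jacobi (\<alpha> + 1) (\<beta> - 1))) (act (first_order_op 1 1 (of_real \<beta>)) p) =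
        act (first_order_op 1 1 (of_real \<beta>)) (act (classical_op (Jacobi \<alpha> \<beta>)) p)" for p
      unfolding act_classical_op act_first_order_op
      by (rule poly_ext) (simp add: pderiv_add pderiv_mult pderiv_pCons pderiv_smult pderiv_minus pderiv_diff, simp add: algebra_simps)
  qed (use assms in \<open>auto simp: algebra_simps\<close>)
qed

lemma darboux_map_Jacobi_down:
  assumes "\<alpha> > -1" "\<beta> > 0"
  shows "darboux_map (Jacobi (\<alpha> + 1) (\<beta> - 1)) (Jacobi \<alpha> \<beta>) (first_order_op 1 (-1) (- of_real \<alpha> - 1))"
  unfolding darboux_map_def
proof
  show "degree_preserving (first_order_op 1 (-1) (- of_real \<alpha> - 1))"
  proof (rule degree_preserving_first_order_op)
    fix n
    have "complex_of_real (- real n + (- \<alpha> - 1)) \<noteq> 0"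
      using assms unfolding of_real_eq_0_iff by simp
    then show "- 1 * complex_of_nat n + (- of_real \<alpha> - 1) \<noteq> 0" by simp
  qed
  show "intertwines (Jacobi (\<alpha> + 1) (\<beta> - 1)) (Jacobi \<alpha> \<beta>) (first_order_op 1 (-1) (- of_real \<alpha> - 1))"
  proof (rule intertwinesI)
    show "act (classical_op (Jacobi \<alpha> \<beta>)) (act (first_order_op 1 (-1) (- of_real \<alpha> - 1)) p) =
        act (first_order_op 1 (-1) (- of_real \<alpha> - 1)) (act (classical_op (Jacobi (\<alpha> + 1) (\<beta> - 1))) p)" for p
      unfolding act_classical_op act_first_order_op
      by (rule poly_ext) (simp add: pderiv_add pderiv_mult pderiv_pCons pderiv_smult pderiv_minus pderiv_diff, simp add: algebra_simps)
  qed (use assms in \<open>auto simp: algebra_simps\<close>)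
qed

definition darboux_maps_both :: "classical \<Rightarrow> classical \<Rightarrow> bool" where
  "darboux_maps_both c d \<longleftrightarrow> (\<exists>V. darboux_map c d V) \<and> (\<exists>V. darboux_map d c V)"

lemma darboux_maps_both_refl: "darboux_maps_both c c"
  using darboux_map_one by (auto simp: darboux_maps_both_def)

lemma darboux_maps_both_sym: "darboux_maps_both c d \<Longrightarrow> darboux_maps_both d c"
  by (auto simp: darboux_maps_both_def)

lemma darboux_maps_both_trans:
  "darboux_maps_both c d \<Longrightarrow> darboux_maps_both d e \<Longrightarrow> darboux_maps_both c e"
  unfolding darboux_maps_both_def using darboux_map_mult by meson

lemma darboux_maps_both_Laguerre:
  "\<alpha> > -1 \<Longrightarrow> darboux_maps_both (Laguerre \<alpha>) (Laguerre (\<alpha> + real n))"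
proof (induction n)
  case (Suc n)
  have "darboux_maps_both (Laguerre (\<alpha> + real n)) (Laguerre (\<alpha> + real n + 1))"
    using darboux_map_Laguerre_up[of "\<alpha> + real n"] darboux_map_Laguerre_down[of "\<alpha> + real n"] Suc.prems
    unfolding darboux_maps_both_def by fastforce
  then show ?case using darboux_maps_both_trans[OF Suc.IH[OF Suc.prems]] by (simp add: add_ac)
qed (simp add: darboux_maps_both_refl)

text \<open>
  The bound on the final \<open>\<beta>\<close> makes every step legitimate: a step starts from a value that is larger by at
  least one, hence positive.
\<close>

lemma darboux_maps_both_Jacobi:
  "\<alpha> > -1 \<Longrightarrow> \<beta> - real n > -1 \<Longrightarrow> darboux_maps_both (Jacobi \<alpha> \<beta>) (Jacobi (\<alpha> + real n) (\<beta> - real n))"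
proof (induction n)
  case (Suc n)
  have "darboux_maps_both (Jacobi (\<alpha> + real n) (\<beta> - real n)) (Jacobi (\<alpha> + real n + 1) (\<beta> - real n - 1))"
    using darboux_map_Jacobi_up[of "\<alpha> + real n" "\<beta> - real n"]
      darboux_map_Jacobi_down[of "\<alpha> + real n" "\<beta> - real n"] Suc.prems
    unfolding darboux_maps_both_def by fastforce
  moreover have "darboux_maps_both (Jacobi \<alpha> \<beta>) (Jacobi (\<alpha> + real n) (\<beta> - real n))"
    using Suc by simp
  ultimately show ?case using darboux_maps_both_trans by (simp add: add_ac diff_diff_eq) 
qed (simp add: darboux_maps_both_refl)

lemma integer_shift_imp_darboux_maps:
  assumes "admissible c" "admissible d" "integer_shift c d"
  shows "darboux_maps_both c d"
  using assms
proof (cases rule: integer_shift.cases[of "(c, d)"])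
  case (1 a b)
  then show ?thesis using assms darboux_maps_both_refl by simp
next
  case (2 \<alpha> \<alpha>')
  then obtain k where k: "\<alpha>' = \<alpha> + real_of_int k" using assms(3) by (auto elim!: Ints_cases simp: algebra_simps)
  show ?thesis
  proof (cases "k \<ge> 0")
    case True
    then have "\<alpha>' = \<alpha> + real (nat k)" using k by simp
    then show ?thesis using 2 assms darboux_maps_both_Laguerre by simp
  next
    case False
    then have "\<alpha> = \<alpha>' + real (nat (- k))" using k by simp
    then show ?thesis using 2 assms darboux_maps_both_Laguerre[of \<alpha>'] darboux_maps_both_sym by simp
  qed
next
  case (3 \<alpha> \<beta> \<alpha>' \<beta>')
  then obtain k where k: "\<alpha>' = \<alpha> + real_of_int k" "\<beta>' = \<beta> - real_of_int k"
    using assms(3) by (auto elim!: Ints_cases simp: algebra_simps)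
  show ?thesis
  proof (cases "k \<ge> 0")
    case True
    then have "\<alpha>' = \<alpha> + real (nat k)" "\<beta>' = \<beta> - real (nat k)" using k by simp_all
    then show ?thesis using 3 assms darboux_maps_both_Jacobi by simp
  next
    case False
    then have "\<alpha> = \<alpha>' + real (nat (- k))" "\<beta> = \<beta>' - real (nat (- k))" using k by simp_all
    then show ?thesis using 3 assms darboux_maps_both_Jacobi[of \<alpha>'] darboux_maps_both_sym by simp
  qed
qed (use assms in auto)

section \<open>Moments and orthogonality\<close>

lemma has_bochner_integral_from_has_integral:
  fixes f :: "real \<Rightarrow> real"
  assumes "f \<in> borel_measurable borel" "\<And>x. 0 \<le> f x" "(f has_integral r) UNIV"
  shows "has_bochner_integral lborel f r"
  using nn_integral_has_integral_lborel[OF assms] has_integral_nonneg[OF assms(3)] assms(1,2)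
  by (intro has_bochner_integral_nn_integral) auto

fun base_point :: "classical \<Rightarrow> real" where
  "base_point (Hermite b) = b"
| "base_point (Laguerre \<alpha>) = 0"
| "base_point (Jacobi \<alpha> \<beta>) = -1"

text \<open>
  Moments about the base point, where they have a two-term recurrence: values of a Gaussian, Gamma or Beta
  integral.
\<close>

fun moment :: "classical \<Rightarrow> nat \<Rightarrow> real" where
  "moment (Hermite b) n = (if even n then exp (b ^ 2) * sqrt pi * (fact n / (4 ^ (n div 2) * fact (n div 2))) else 0)"
| "moment (Laguerre \<alpha>) n = Gamma (\<alpha> + real n + 1)"
| "moment (Jacobi \<alpha> \<beta>) n = 2 * 2 powr (\<alpha> + \<beta> + real n) * Beta (\<beta> + real n + 1) (\<alpha> + 1)"

lemma moment_integral_Hermite: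
  "has_bochner_integral lborel (\<lambda>x. (x - b) ^ n * weight (Hermite b) x) (moment (Hermite b) n)"
proof -
  define \<sigma> :: real where "\<sigma> = 1 / sqrt 2"
  have \<sigma>: "\<sigma> > 0" "\<sigma>\<^sup>2 = 1 / 2" by (simp_all add: \<sigma>_def power_divide)
  define C where "C = exp (b ^ 2) * sqrt pi"
  have w: "(x - b) ^ n * weight (Hermite b) x = C * (normal_density b \<sigma> x * (x - b) ^ n)" for x
  proof -
    have "- (x ^ 2) + 2 * b * x = b ^ 2 + - ((x - b) ^ 2)" by (simp add: power2_eq_square algebra_simps)
    then have "weight (Hermite b) x = exp (b ^ 2) * exp (- ((x - b) ^ 2))"
      by (simp only: weight.simps exp_add)
    then show ?thesis by (simp add: normal_density_def \<sigma> C_def)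
  qed
  show ?thesis
  proof (cases "even n")
    case True
    then obtain k where n: "n = 2 * k" by (elim evenE)
    have "has_bochner_integral lborel (\<lambda>x. C * (normal_density b \<sigma> x * (x - b) ^ (2 * k)))
        (C * (fact (2 * k) / ((2 / \<sigma>\<^sup>2) ^ k * fact k)))"
      by (rule has_bochner_integral_mult_right) (use normal_moment_even[OF \<sigma>(1)] in blast)
    then show ?thesis unfolding w by (simp add: n \<sigma> C_def)
  next
    case False
    then obtain k where n: "n = 2 * k + 1" by (elim oddE)
    have "has_bochner_integral lborel (\<lambda>x. C * (normal_density b \<sigma> x * (x - b) ^ (2 * k + 1))) (C * 0)"
      by (rule has_bochner_integral_mult_right) (use normal_moment_odd[OF \<sigma>(1)] in blast)
    then show ?thesis unfolding w by (simp add: n)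
  qed
qed

lemma moment_integral_Laguerre:
  assumes "\<alpha> > -1"
  shows "has_bochner_integral lborel (\<lambda>x. x ^ n * weight (Laguerre \<alpha>) x) (moment (Laguerre \<alpha>) n)"
proof (rule has_bochner_integral_from_has_integral)
  have "((\<lambda>t. t powr (\<alpha> + real n + 1 - 1) / exp t) has_integral Gamma (\<alpha> + real n + 1)) {0..}"
    using assms by (intro Gamma_integral_real) simp
  then have "((\<lambda>t. if t \<in> {0..} then t powr (\<alpha> + real n + 1 - 1) / exp t else 0) has_integral Gamma (\<alpha> + real n + 1)) UNIV"
    by (simp only: has_integral_restrict_UNIV)
  moreover have "(if t \<in> {0..} then t powr (\<alpha> + real n + 1 - 1) / exp t else 0) = t ^ n * weight (Laguerre \<alpha>) t" for t
    by (cases "t = 0") (simp_all add: powr_add powr_realpow exp_minus field_simps)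
  ultimately show "((\<lambda>x. x ^ n * weight (Laguerre \<alpha>) x) has_integral moment (Laguerre \<alpha>) n) UNIV"
    by simp
qed auto

lemma moment_integral_Jacobi:
  assumes "\<alpha> > -1" "\<beta> > -1"
  shows "has_bochner_integral lborel (\<lambda>x. (x + 1) ^ n * weight (Jacobi \<alpha> \<beta>) x) (moment (Jacobi \<alpha> \<beta>) n)"
proof -
  define C where "C = 2 powr (\<alpha> + \<beta> + real n)"
  let ?f = "\<lambda>x. (x + 1) ^ n * weight (Jacobi \<alpha> \<beta>) x"
  have C: "C = 2 ^ n * (2 powr \<alpha> * 2 powr \<beta>)"
    by (simp add: C_def powr_add powr_realpow)
  have "has_bochner_integral lborel (\<lambda>t. ?f (-1 + 2 * t)) (C * Beta (\<beta> + real n + 1) (\<alpha> + 1))"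
  proof (rule has_bochner_integral_from_has_integral)
    have "((\<lambda>t. C * (t powr (\<beta> + real n + 1 - 1) * (1 - t) powr (\<alpha> + 1 - 1))) has_integral
        C * Beta (\<beta> + real n + 1) (\<alpha> + 1)) {0..1}"
      using assms by (intro has_integral_mult_right has_integral_Beta_real) simp_all
    then have "((\<lambda>t. if t \<in> {0..1} then C * (t powr (\<beta> + real n + 1 - 1) * (1 - t) powr (\<alpha> + 1 - 1)) else 0)
        has_integral C * Beta (\<beta> + real n + 1) (\<alpha> + 1)) UNIV"
      by (simp only: has_integral_restrict_UNIV)
    moreover have "(if t \<in> {0..1} then C * (t powr (\<beta> + real n + 1 - 1) * (1 - t) powr (\<alpha> + 1 - 1)) else 0)
        = ?f (-1 + 2 * t)" for t
    proof (cases "0 < t \<and> t < 1")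
      case True
      have "(2 - 2 * t) powr \<alpha> = 2 powr \<alpha> * (1 - t) powr \<alpha>"
        using True powr_mult[of 2 "1 - t" \<alpha>] by (simp add: algebra_simps)
      moreover have "(2 * t) powr \<beta> = 2 powr \<beta> * t powr \<beta>"
        using True powr_mult[of 2 t \<beta>] by simp
      ultimately show ?thesis
        using True by (simp add: C powr_add powr_realpow power_mult_distrib mult_ac)
    next
      case False
      then show ?thesis by (cases "t = 0"; cases "t = 1") auto
    qed
    ultimately show "((\<lambda>t. ?f (-1 + 2 * t)) has_integral C * Beta (\<beta> + real n + 1) (\<alpha> + 1)) UNIV"
      by simp
  qed auto
  then have "has_bochner_integral lborel (\<lambda>t. ?f (-1 + 2 * t)) ((2 * (C * Beta (\<beta> + real n + 1) (\<alpha> + 1))) /\<^sub>R \<bar>2\<bar>)"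
    by simp
  then have "has_bochner_integral lborel ?f (2 * (C * Beta (\<beta> + real n + 1) (\<alpha> + 1)))"
    by (subst lborel_has_bochner_integral_real_affine_iff[of 2 _ _ "-1"]) simp_all
  then show ?thesis by (simp add: C_def mult.assoc)
qed

lemma moment_integral:
  assumes "admissible c"
  shows "has_bochner_integral lborel (\<lambda>x. (x - base_point c) ^ n * weight c x) (moment c n)"
proof (cases c)
  case (Hermite b)
  then show ?thesis using moment_integral_Hermite by simp
next
  case (Laguerre \<alpha>)
  then show ?thesis using moment_integral_Laguerre[of \<alpha> n] assms by simp
next
  case (Jacobi \<alpha> \<beta>)
  then show ?thesis using moment_integral_Jacobi[of \<alpha> \<beta> n] assms by simp
qed

definition weight_integral :: "classical \<Rightarrow> complex poly \<Rightarrow> complex" where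
  "weight_integral c p = (LINT x|lborel. poly p (complex_of_real x) * complex_of_real (weight c x))"

text \<open>
  Induction over the Taylor expansion at \<open>z\<close>; it reduces linear statements about the weight integral to the
  moments about the base point.
\<close>

lemma linear_power_span_induct:
  fixes z :: "'a :: comm_ring_1"
  assumes pow: "\<And>a k. P (Polynomial.smult a ([:- z, 1:] ^ k))"
    and add: "\<And>p q. P p \<Longrightarrow> P q \<Longrightarrow> P (p + q)"
  shows "P p"
proof -
  have "P (\<Sum>k\<in>A. Polynomial.smult (a k) ([:- z, 1:] ^ k))" if "finite A" for A a
    using that
  proof (induction A)
    case empty
    show ?case using pow[of 0 0] by simp
  qed (simp add: add pow)
  moreover have "p = pcompose (pcompose p [:z, 1:]) [:- z, 1:]"
    by (simp add: pcompose_assoc[symmetric] pcompose_pCons)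
  moreover have "pcompose q [:- z, 1:] = (\<Sum>k\<le>degree q. Polynomial.smult (coeff q k) ([:- z, 1:] ^ k))" for q
    by (simp add: pcompose_altdef poly_altdef coeff_map_poly degree_map_poly)
  ultimately show ?thesis by (metis finite_atMost)
qed

lemma
  assumes "admissible c"
  shows weight_integrable: "integrable lborel (\<lambda>x. poly p (complex_of_real x) * complex_of_real (weight c x))" (is "integrable _ (?f p)")
    and weight_integral_base: "weight_integral c ([:- of_real (base_point c), 1:] ^ k) = of_real (moment c k)"
proof -
  have hb: "has_bochner_integral lborel (?f ([:- of_real (base_point c), 1:] ^ k)) (complex_of_real (moment c k))" for k
  proof -
    have "has_bochner_integral lborel (\<lambda>x. complex_of_real ((x - base_point c) ^ k * weight c x)) (complex_of_real (moment c k))"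
      using moment_integral[OF assms] by (rule has_bochner_integral_of_real)
    then show ?thesis by simp
  qed
  show "weight_integral c ([:- of_real (base_point c), 1:] ^ k) = of_real (moment c k)"
    unfolding weight_integral_def using hb[of k] by (rule has_bochner_integral_integral_eq)
  show "integrable lborel (?f p)"
  proof (induction p rule: linear_power_span_induct[where z = "complex_of_real (base_point c)"])
    case (1 a k)
    have "integrable lborel (\<lambda>x. a * ?f ([:- of_real (base_point c), 1:] ^ k) x)"
      using hb[of k] by (intro integrable_mult_right) (rule has_bochner_integral_iff[THEN iffD1, THEN conjunct1])
    then show ?case by (simp add: mult.assoc)
  next
    case (2 p q)
    then have "integrable lborel (\<lambda>x. ?f p x + ?f q x)" by simp
    then show ?case by (simp add: algebra_simps)
  qed
qed

lemma weight_integral_add: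
  "admissible c \<Longrightarrow> weight_integral c (p + q) = weight_integral c p + weight_integral c q"
  using weight_integrable[of c p] weight_integrable[of c q]
  by (simp add: weight_integral_def distrib_right flip: Bochner_Integration.integral_add)

lemma weight_integral_smult: "weight_integral c (Polynomial.smult a p) = a * weight_integral c p"
  by (simp add: weight_integral_def mult.assoc)

lemma weight_integral_diff:
  "admissible c \<Longrightarrow> weight_integral c (p - q) = weight_integral c p - weight_integral c q"
  using weight_integrable[of c p] weight_integrable[of c q]
  by (simp add: weight_integral_def left_diff_distrib flip: Bochner_Integration.integral_diff)

lemma weight_integral_0: "weight_integral c 0 = 0"
  by (simp add: weight_integral_def)

lemma moment_recurrence_Hermite:
  "2 * moment (Hermite b) (Suc (Suc k)) = real (Suc k) * moment (Hermite b) k"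
proof (cases "even k")
  case True
  then obtain m where "k = 2 * m" by (elim evenE)
  moreover have "fact (Suc (Suc (2 * m))) = 2 * (real m + 1) * (2 * real m + 1) * fact (2 * m)"
    by (simp add: algebra_simps)
  ultimately show ?thesis by (simp add: field_simps del: fact_Suc) (simp add: field_simps)
qed simp

lemma real_pos_notin_nonpos_Ints: "(x::real) > 0 \<Longrightarrow> x \<notin> \<int>\<^sub>\<le>\<^sub>0"
  by (auto simp: nonpos_Ints_def)

lemma moment_recurrence_Laguerre:
  assumes "\<alpha> > -1"
  shows "moment (Laguerre \<alpha>) (Suc k) = (\<alpha> + real k + 1) * moment (Laguerre \<alpha>) k"
  using Gamma_plus1[OF real_pos_notin_nonpos_Ints, of "\<alpha> + real k + 1"] assms
  by (simp add: add_ac)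

lemma moment_recurrence_Jacobi:
  assumes "\<alpha> > -1" "\<beta> > -1"
  shows "(real k + \<alpha> + \<beta> + 2) * moment (Jacobi \<alpha> \<beta>) (Suc k) = 2 * (real k + \<beta> + 1) * moment (Jacobi \<alpha> \<beta>) k"
proof -
  define B where "B x = Beta x (\<alpha> + 1)" for x
  have "(\<beta> + real k + 1 + (\<alpha> + 1)) * B (\<beta> + real k + 1 + 1) = (\<beta> + real k + 1) * B (\<beta> + real k + 1)"
    unfolding B_def using Beta_plus1_left[OF real_pos_notin_nonpos_Ints, of "\<beta> + real k + 1" "\<alpha> + 1"] assms
    by simp
  then have *: "(real k + \<alpha> + \<beta> + 2) * B (\<beta> + real (Suc k) + 1) = (real k + \<beta> + 1) * B (\<beta> + real k + 1)"
    by (simp add: add_ac)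
  have "2 powr (\<alpha> + \<beta> + real (Suc k)) = 2 * 2 powr (\<alpha> + \<beta> + real k)"
    by (simp add: powr_add)
  then have "(real k + \<alpha> + \<beta> + 2) * moment (Jacobi \<alpha> \<beta>) (Suc k) =
      2 * (2 * 2 powr (\<alpha> + \<beta> + real k)) * ((real k + \<alpha> + \<beta> + 2) * B (\<beta> + real (Suc k) + 1))"
    unfolding moment.simps B_def by simp
  also have "\<dots> = 2 * (real k + \<beta> + 1) * moment (Jacobi \<alpha> \<beta>) k"
    unfolding * by (simp add: B_def)
  finally show ?thesis .
qed

lemma linear_times_pderiv_power:
  fixes z :: complex
  shows "[:- z, 1:] * pderiv ([:- z, 1:] ^ k) = Polynomial.smult (of_nat k) ([:- z, 1:] ^ k)"
proof (cases k)
  case (Suc m)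
  have "pderiv ([:- z, 1:] ^ Suc m) = Polynomial.smult (of_nat (Suc m)) ([:- z, 1:] ^ m)"
    by (simp only: pderiv_power_Suc) (simp add: pderiv_pCons)
  then show ?thesis unfolding Suc by (simp only: mult_smult_right power_Suc)
qed simp

text \<open>
  This is the Pearson equation \<open>(a w)' = b w\<close> in integrated form, with the boundary terms already gone.
  On powers of \<open>x - base_point c\<close> it is the recurrence of the moments, so no limits have to be taken.
\<close>

lemma weight_integral_pearson:
  assumes c: "admissible c"
  shows "weight_integral c (top_coeff c * pderiv h + sub_coeff c * h) = 0"
proof (induction h rule: linear_power_span_induct[where z = "complex_of_real (base_point c)"])
  case (1 a k)
  define L where "L = [:- complex_of_real (base_point c), 1:]"
  note int = weight_integral_base[OF c, folded L_def]
  have Lk: "L * pderiv (L ^ k) = Polynomial.smult (of_nat k) (L ^ k)"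
    unfolding L_def by (rule linear_times_pderiv_power)
  have comb: "weight_integral c (Polynomial.smult u (L ^ i) - Polynomial.smult v (L ^ j)) =
      u * of_real (moment c i) - v * of_real (moment c j)" for u v i j
    by (simp only: weight_integral_diff[OF c] weight_integral_smult int)
  have "weight_integral c (top_coeff c * pderiv (L ^ k) + sub_coeff c * L ^ k) = 0"
  proof (cases c)
    case (Hermite b)
    have top: "top_coeff c = 1" and sub: "sub_coeff c = - Polynomial.smult 2 L"
      by (simp_all add: Hermite L_def)
    show ?thesis
    proof (cases k)
      case 0
      have "top_coeff c * pderiv (L ^ k) + sub_coeff c * L ^ k
          = Polynomial.smult 0 (L ^ 0) - Polynomial.smult 2 (L ^ 1)"
        unfolding top sub by (simp add: 0)
      then show ?thesis by (simp only: comb) (simp add: Hermite)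
    next
      case (Suc j)
      have pd: "pderiv (L ^ k) = Polynomial.smult (of_nat k) (L ^ j)"
        unfolding Suc L_def by (simp only: pderiv_power_Suc) (simp add: pderiv_pCons)
      have "top_coeff c * pderiv (L ^ k) + sub_coeff c * L ^ k
          = Polynomial.smult (of_nat k) (L ^ j) - Polynomial.smult 2 (L ^ Suc k)"
        unfolding top sub pd by simp
      moreover have "2 * moment c (Suc k) = real k * moment c j"
        unfolding Hermite Suc by (rule moment_recurrence_Hermite)
      from arg_cong[OF this, of complex_of_real]
      have "of_nat k * of_real (moment c j) - 2 * complex_of_real (moment c (Suc k)) = 0"
        by (simp del: moment.simps)
      ultimately show ?thesis by (simp only: comb)
    qed
  next
    case (Laguerre \<alpha>)
    have top: "top_coeff c = L" and sub: "sub_coeff c = [:of_real \<alpha> + 1:] - L"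
      by (simp_all add: Laguerre L_def)
    have "top_coeff c * pderiv (L ^ k) + sub_coeff c * L ^ k
        = Polynomial.smult (of_nat k + (of_real \<alpha> + 1)) (L ^ k) - Polynomial.smult 1 (L ^ Suc k)"
      unfolding top sub Lk by (simp add: left_diff_distrib smult_add_left)
    moreover have "moment c (Suc k) = (\<alpha> + real k + 1) * moment c k"
      using moment_recurrence_Laguerre[of \<alpha> k] c Laguerre by simp
    from arg_cong[OF this, of complex_of_real]
    have "(of_nat k + (of_real \<alpha> + 1)) * of_real (moment c k) - 1 * complex_of_real (moment c (Suc k)) = 0"
      by (simp add: add_ac del: moment.simps)
    ultimately show ?thesis by (simp only: comb)
  next
    case (Jacobi \<alpha> \<beta>)
    define s t where "s = complex_of_real \<alpha> + of_real \<beta> + 2" and "t = 2 * (complex_of_real \<beta> + 1)"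
    have top: "top_coeff c = [:2:] * L - L * L" and sub: "sub_coeff c = [:t:] - [:s:] * L"
      by (simp_all add: Jacobi L_def s_def t_def)
    have "top_coeff c * pderiv (L ^ k) + sub_coeff c * L ^ k = [:2:] * (L * pderiv (L ^ k))
        - L * (L * pderiv (L ^ k)) + ([:t:] - [:s:] * L) * L ^ k"
      unfolding top sub by (simp only: left_diff_distrib mult.assoc)
    also have "\<dots> = Polynomial.smult (of_nat k * 2 + t) (L ^ k) - Polynomial.smult (of_nat k + s) (L ^ Suc k)"
      unfolding Lk by (simp add: left_diff_distrib smult_add_left)
    finally have "top_coeff c * pderiv (L ^ k) + sub_coeff c * L ^ k =
        Polynomial.smult (of_nat k * 2 + t) (L ^ k) - Polynomial.smult (of_nat k + s) (L ^ Suc k)" .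
    moreover have "(real k + \<alpha> + \<beta> + 2) * moment c (Suc k) = 2 * (real k + \<beta> + 1) * moment c k"
      using moment_recurrence_Jacobi[of \<alpha> \<beta> k] c Jacobi by simp
    from arg_cong[OF this, of complex_of_real]
    have "(of_nat k * 2 + t) * of_real (moment c k) - (of_nat k + s) * complex_of_real (moment c (Suc k)) = 0"
      by (simp add: s_def t_def add.assoc distrib_left del: moment.simps)
    ultimately show ?thesis by (simp only: comb)
  qed
  then have "weight_integral c (Polynomial.smult a (top_coeff c * pderiv (L ^ k) + sub_coeff c * L ^ k)) = 0"
    by (simp add: weight_integral_smult)
  then show ?case by (simp add: L_def pderiv_smult smult_add_right)
next
  case (2 p q)
  have "top_coeff c * pderiv (p + q) + sub_coeff c * (p + q) =
      (top_coeff c * pderiv p + sub_coeff c * p) + (top_coeff c * pderiv q + sub_coeff c * q)"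
    by (simp add: pderiv_add algebra_simps)
  then show ?case using 2 by (simp only: weight_integral_add[OF c]) simp
qed

text \<open>
  The difference of the two integrands is \<open>a h' + b h\<close> for the Wronskian-like \<open>h = p' q - p q'\<close>.
\<close>

lemma classical_op_symmetric:
  assumes c: "admissible c"
  shows "weight_integral c (act (classical_op c) p * q) = weight_integral c (p * act (classical_op c) q)"
proof -
  define h where "h = pderiv p * q - p * pderiv q"
  have "act (classical_op c) p * q - p * act (classical_op c) q = top_coeff c * pderiv h + sub_coeff c * h"
    by (simp add: act_classical_op h_def pderiv_diff pderiv_mult algebra_simps)
  then have "weight_integral c (act (classical_op c) p * q - p * act (classical_op c) q) = 0"
    using weight_integral_pearson[OF c] by simp
  then show ?thesis by (simp add: weight_integral_diff[OF c])
qed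

lemma eigenpoly_orthogonal:
  assumes c: "admissible c" and "m \<noteq> n"
  shows "weight_integral c (eigenpoly c m * eigenpoly c n) = 0"
proof -
  have "(eigval c m - eigval c n) * weight_integral c (eigenpoly c m * eigenpoly c n) = 0"
    using classical_op_symmetric[OF c, of "eigenpoly c m" "eigenpoly c n"]
    by (simp add: act_eigenpoly[OF c] weight_integral_smult left_diff_distrib)
  then show ?thesis using eigval_inj[OF c, of m n] assms(2) by auto
qed

lemma map_poly_cnj_mult: "map_poly cnj (p * q) = map_poly cnj p * map_poly cnj q"
  by (rule poly_ext) simp

lemma map_poly_cnj_add: "map_poly cnj (p + q) = map_poly cnj p + map_poly cnj q"
  by (rule poly_ext) simp

lemma map_poly_cnj_pderiv: "map_poly cnj (pderiv p) = pderiv (map_poly cnj p)"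
  by (rule poly_eqI) (simp add: coeff_map_poly coeff_pderiv)

text \<open>
  The operator and its eigenvalues are real, so conjugating the coefficients gives again a monic
  eigenpolynomial; the sesquilinear pairing of the eigenpolynomials is thereby the bilinear one.
\<close>

lemma map_poly_cnj_eigenpoly:
  assumes c: "admissible c"
  shows "map_poly cnj (eigenpoly c n) = eigenpoly c n"
proof -
  have top: "map_poly cnj (top_coeff c) = top_coeff c"
    by (rule poly_ext) (cases c; simp)
  have sub: "map_poly cnj (sub_coeff c) = sub_coeff c"
    by (rule poly_ext) (cases c; simp)
  have eig: "cnj (eigval c n) = eigval c n"
    by (cases c) simp_all
  have "act (classical_op c) (map_poly cnj (eigenpoly c n)) = map_poly cnj (act (classical_op c) (eigenpoly c n))"
    by (simp only: act_classical_op map_poly_cnj_add map_poly_cnj_mult map_poly_cnj_pderiv top sub)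
  also have "\<dots> = Polynomial.smult (eigval c n) (map_poly cnj (eigenpoly c n))"
    by (simp only: act_eigenpoly[OF c] map_poly_smult[of cnj] complex_cnj_mult eig complex_cnj_zero)
  finally obtain a where a: "map_poly cnj (eigenpoly c n) = Polynomial.smult a (eigenpoly c n)"
    using eigenpoly_unique[OF c] by blast
  from arg_cong[OF a, of "\<lambda>p. coeff p n"] have "a = 1"
    by (simp add: coeff_map_poly coeff_eigenpoly[OF c])
  then show ?thesis using a by simp
qed

lemma weight_nonneg: "weight c x \<ge> 0"
  by (cases c) auto

lemma weight_pos: "0 < x \<Longrightarrow> x < 1 \<Longrightarrow> weight c x > 0"
  by (cases c) auto

text \<open>
  On \<open>(0, 1)\<close> all classical weights are positive. A polynomial of norm zero vanishes almost everywhere there,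
  so it has infinitely many zeros.
\<close>

lemma weight_integral_positive:
  assumes c: "admissible c"
  obtains r where "weight_integral c (p * map_poly cnj p) = of_real r" "r \<ge> 0" "r = 0 \<Longrightarrow> p = 0"
proof -
  define f where "f x = (cmod (poly p (complex_of_real x)))\<^sup>2 * weight c x" for x
  have f: "poly (p * map_poly cnj p) (complex_of_real x) * complex_of_real (weight c x) = of_real (f x)" for x
    by (simp only: f_def of_real_mult complex_norm_square poly_mult poly_map_poly_cnj complex_cnj_complex_of_real)
  have int: "integrable lborel f"
    using weight_integrable[OF c, of "p * map_poly cnj p"] unfolding f complex_of_real_integrable_eq .
  show thesis
  proof (rule that)
    show "weight_integral c (p * map_poly cnj p) = of_real (integral\<^sup>L lborel f)"
      unfolding weight_integral_def f by (rule integral_complex_of_real)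
    show "integral\<^sup>L lborel f \<ge> 0"
      by (intro integral_nonneg_AE) (simp add: f_def weight_nonneg)
    assume "integral\<^sup>L lborel f = 0"
    then have "AE x in lborel. f x = 0"
      using integral_nonneg_eq_0_iff_AE[OF int] by (simp add: f_def weight_nonneg)
    then have ae: "AE x in lborel. x \<in> {0<..<1} \<longrightarrow> poly p (complex_of_real x) = 0"
    proof (rule eventually_mono, intro impI)
      fix x :: real assume "f x = 0" "x \<in> {0<..<1}"
      then show "poly p (complex_of_real x) = 0" using weight_pos[of x c] by (auto simp: f_def)
    qed
    show "p = 0"
    proof (rule ccontr)
      assume "p \<noteq> 0"
      then have "finite {z. poly p z = 0}" by (rule poly_roots_finite)
      then have "finite (of_real -` {z. poly p z = 0} :: real set)"
        by (rule finite_vimageI) (simp add: inj_on_def)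
      then have "of_real -` {z. poly p z = 0} \<in> null_sets lborel" by (rule finite_imp_null_set_lborel)
      then have "AE x in lborel. x \<notin> of_real -` {z. poly p z = 0}" by (rule AE_not_in)
      with ae have "AE x in lborel. x \<notin> {0<..<1::real}" by eventually_elim auto
      then have "{0<..<1::real} \<in> null_sets lborel" by (subst AE_iff_null_sets) auto
      then show False by (simp add: null_sets_def)
    qed
  qed
qed

section \<open>The algebra of a direct sum of classical weights\<close>

lemma diag_block_mat_concat: "diag_block_mat (concat Ass) = diag_block_mat (map diag_block_mat Ass)"
  by (induction Ass) (simp_all add: diag_block_mat_append Let_def)

lemma diag_block_mat_singletons:
  "diag_block_mat (map (\<lambda>a. Matrix.mat 1 1 (\<lambda>_. g a)) xs) = mat_diag (length xs) (\<lambda>j. g (xs ! j))"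
proof (induction xs)
  case Nil
  show ?case by (rule eq_matI) (auto simp: mat_diag_def)
next
  case (Cons a xs)
  show ?case
    unfolding list.map diag_block_mat.simps Let_def Cons.IH
    by (rule eq_matI) (auto simp: mat_diag_def nth_Cons')
qed

text \<open>
  Nested direct sums of diagonal matrices are flattened here, which turns the block structure into an
  index set.
\<close>

lemma diag_block_mat_diags:
  "diag_block_mat (map (\<lambda>xs. mat_diag (length xs) (\<lambda>j. g (xs ! j))) xss)
     = mat_diag (length (concat xss)) (\<lambda>j. g (concat xss ! j))"
proof -
  let ?h = "\<lambda>a. Matrix.mat 1 1 (\<lambda>_. g a)"
  have "diag_block_mat (map (\<lambda>xs. mat_diag (length xs) (\<lambda>j. g (xs ! j))) xss)
      = diag_block_mat (map diag_block_mat (map (map ?h) xss))"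
    by (simp add: diag_block_mat_singletons comp_def del: One_nat_def)
  also have "\<dots> = diag_block_mat (map ?h (concat xss))"
    by (simp only: diag_block_mat_concat[symmetric] map_concat)
  finally show ?thesis by (simp add: diag_block_mat_singletons del: One_nat_def)
qed

lemma classical_sum_diag:
  "classical_sum cs x = mat_diag (length cs) (\<lambda>k. complex_of_real (weight (cs ! k) x))"
  by (simp add: classical_sum_def direct_sum_def scalar_matrix_def comp_def
      diag_block_mat_singletons[where g = "\<lambda>c. complex_of_real (weight c x)"] del: One_nat_def)

lemma direct_sum_classical_sums: "direct_sum (map classical_sum css) = classical_sum (concat css)"
proof
  fix x
  show "direct_sum (map classical_sum css) x = classical_sum (concat css) x"
    by (simp add: direct_sum_def comp_def classical_sum_diag
        diag_block_mat_diags[where g = "\<lambda>c. complex_of_real (weight c x)"])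
qed

lemma mat_adjoint_index:
  "i < dim_col A \<Longrightarrow> j < dim_row A \<Longrightarrow> mat_adjoint A $$ (i, j) = conjugate (A $$ (j, i))"
  by (simp add: mat_adjoint_def mat_of_rows_index)

text \<open>
  An entry of the matrix-valued inner product pairs one row of each argument, and for a diagonal weight this
  pairing is a sum of scalar ones.
\<close>

definition row_inner :: "classical list \<Rightarrow> (nat \<Rightarrow> complex poly) \<Rightarrow> (nat \<Rightarrow> complex poly) \<Rightarrow> complex" where
  "row_inner cs u v = (\<Sum>k<length cs. weight_integral (cs ! k) (u k * map_poly cnj (v k)))"

lemma weight_inner_index:
  assumes adm: "\<And>c. c \<in> set cs \<Longrightarrow> admissible c"
    and P: "P \<in> carrier_mat (length cs) (length cs)" and Q: "Q \<in> carrier_mat (length cs) (length cs)"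
    and ij: "i < length cs" "j < length cs"
  shows "weight_inner (length cs) (classical_sum cs) P Q $$ (i, j) =
    row_inner cs (\<lambda>k. P $$ (i, k)) (\<lambda>k. Q $$ (j, k))"
proof -
  define N where "N = length cs"
  have entry: "(eval_mat P x * classical_sum cs x * mat_adjoint (eval_mat Q x)) $$ (i, j) =
      (\<Sum>k<N. poly (P $$ (i, k) * map_poly cnj (Q $$ (j, k))) (complex_of_real x) * complex_of_real (weight (cs ! k) x))" for x
  proof -
    have ev: "eval_mat P x \<in> carrier_mat N N" "eval_mat Q x \<in> carrier_mat N N"
      using P Q by (simp_all add: eval_mat_def N_def)
    have "mat_adjoint (eval_mat Q x) \<in> carrier_mat N N"
      using carrier_matD[OF ev(2)] by (intro carrier_matI) (simp_all add: mat_adjoint_def)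
    moreover have "eval_mat P x * classical_sum cs x =
        Matrix.mat N N (\<lambda>(i, k). eval_mat P x $$ (i, k) * complex_of_real (weight (cs ! k) x))"
      unfolding classical_sum_diag N_def[symmetric] by (rule mat_diag_mult_right[OF ev(1)])
    ultimately have "(eval_mat P x * classical_sum cs x * mat_adjoint (eval_mat Q x)) $$ (i, j) =
        (\<Sum>k<N. eval_mat P x $$ (i, k) * complex_of_real (weight (cs ! k) x) * mat_adjoint (eval_mat Q x) $$ (k, j))"
      using ij by (simp add: scalar_prod_def N_def atLeast0LessThan)
    also have "\<dots> = (\<Sum>k<N. eval_mat P x $$ (i, k) * complex_of_real (weight (cs ! k) x) * cnj (eval_mat Q x $$ (j, k)))"
      using ev ij by (intro sum.cong) (auto simp: mat_adjoint_index N_def)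
    finally show ?thesis
      using P Q ij by (simp add: eval_mat_def N_def mult_ac)
  qed
  have "weight_inner N (classical_sum cs) P Q $$ (i, j) = (LINT x|lborel. (\<Sum>k<N.
      poly (P $$ (i, k) * map_poly cnj (Q $$ (j, k))) (complex_of_real x) * complex_of_real (weight (cs ! k) x)))"
    using ij by (simp add: weight_inner_def entry N_def del: poly_mult)
  also have "\<dots> = (\<Sum>k<N. LINT x|lborel.
      poly (P $$ (i, k) * map_poly cnj (Q $$ (j, k))) (complex_of_real x) * complex_of_real (weight (cs ! k) x))"
    by (intro Bochner_Integration.integral_sum weight_integrable adm) (simp add: N_def)
  finally show ?thesis by (simp add: row_inner_def weight_integral_def N_def)
qed

context
  fixes cs :: "classical list"
  assumes adm: "\<And>c. c \<in> set cs \<Longrightarrow> admissible c"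
begin

lemma adm_nth: "k < length cs \<Longrightarrow> admissible (cs ! k)"
  using adm by simp

lemma row_inner_add_right:
  "row_inner cs u (\<lambda>k. v k + w k) = row_inner cs u v + row_inner cs u w"
  unfolding row_inner_def sum.distrib[symmetric]
  by (intro sum.cong refl) (simp add: map_poly_cnj_add distrib_left weight_integral_add adm_nth)

lemma row_inner_smult_right:
  "row_inner cs u (\<lambda>k. Polynomial.smult a (v k)) = cnj a * row_inner cs u v"
  unfolding row_inner_def sum_distrib_left
  by (intro sum.cong refl) (simp add: map_poly_smult weight_integral_smult)

lemma row_inner_sum_right:
  "finite A \<Longrightarrow> row_inner cs u (\<lambda>k. \<Sum>i\<in>A. v i k) = (\<Sum>i\<in>A. row_inner cs u (v i))"
proof (induction A rule: finite_induct)
  case empty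
  show ?case by (simp add: row_inner_def weight_integral_0)
qed (simp add: row_inner_add_right)

lemma row_inner_diff_left:
  "row_inner cs (\<lambda>k. u k - v k) w = row_inner cs u w - row_inner cs v w"
  unfolding row_inner_def sum_subtractf[symmetric]
  by (intro sum.cong refl) (simp add: left_diff_distrib weight_integral_diff adm_nth)

lemma row_inner_definite:
  assumes "row_inner cs u u = 0" "k < length cs"
  shows "u k = 0"
proof -
  have "\<exists>r. weight_integral (cs ! k) (u k * map_poly cnj (u k)) = of_real r \<and> r \<ge> 0 \<and> (r = 0 \<longrightarrow> u k = 0)"
    if "k < length cs" for k
    using weight_integral_positive[OF adm_nth[OF that], of "u k"] by metis
  then obtain r where r: "weight_integral (cs ! k) (u k * map_poly cnj (u k)) = of_real (r k)"
      "r k \<ge> 0" "r k = 0 \<Longrightarrow> u k = 0" if "k < length cs" for k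
    by metis
  have "complex_of_real (\<Sum>k<length cs. r k) = 0"
    using assms(1) by (simp add: row_inner_def r)
  then have "(\<Sum>k<length cs. r k) = 0" by (simp only: of_real_eq_0_iff)
  then have "r k = 0" using assms(2) r(2) by (subst (asm) sum_nonneg_eq_0_iff) auto
  then show ?thesis using r(3) assms(2) by blast
qed

text \<open>
  The rows of \<open>P 0, \<dots>, P m\<close> span all rows of degree at most \<open>m\<close>, because the matrices are monic: subtracting
  the combination with the right leading coefficients lowers the degree.
\<close>

lemma monic_orthogonal_lower:
  assumes P: "is_monic_orthogonal (length cs) (classical_sum cs) P" and i: "i < length cs"
  shows "m \<le> n \<Longrightarrow> (\<And>k t. k < length cs \<Longrightarrow> t \<ge> m \<Longrightarrow> coeff (v k) t = 0) \<Longrightarrow>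
    row_inner cs (\<lambda>k. P n $$ (i, k)) v = 0"
proof (induction m arbitrary: v)
  case 0
  then have "v k = 0" if "k < length cs" for k using that by (intro poly_eqI) simp
  then show ?case by (simp add: row_inner_def weight_integral_0)
next
  case (Suc m)
  define N where "N = length cs"
  have Pm: "P m \<in> carrier_mat N N" "\<And>j k. j < N \<Longrightarrow> k < N \<Longrightarrow> degree (P m $$ (j, k)) \<le> m"
    "map_mat (\<lambda>p. coeff p m) (P m) = 1\<^sub>m N"
    using P unfolding is_monic_orthogonal_def monic_of_degree_def N_def by auto
  have lead: "coeff (P m $$ (j, k)) m = (if j = k then 1 else 0)" if "j < N" "k < N" for j k
    using arg_cong[OF Pm(3), of "\<lambda>A. A $$ (j, k)"] that Pm(1) by simp
  define s where "s k = (\<Sum>j<N. Polynomial.smult (coeff (v j) m) (P m $$ (j, k)))" for k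
  define w where "w k = v k - s k" for k
  have "coeff (w k) t = 0" if "k < N" "t \<ge> m" for k t
  proof (cases "t = m")
    case True
    have "coeff (s k) m = (\<Sum>j<N. coeff (v j) m * (if j = k then 1 else 0))"
      using that by (auto simp: s_def coeff_sum lead intro!: sum.cong)
    also have "\<dots> = coeff (v k) m" using that by (simp add: if_distrib cong: if_cong)
    finally show ?thesis by (simp add: w_def True)
  next
    case False
    then have "coeff (P m $$ (j, k)) t = 0" if "j < N" for j
      using that Pm(2)[of j k] \<open>k < N\<close> \<open>t \<ge> m\<close> by (intro coeff_eq_0) force
    then show ?thesis using that False Suc.prems(2)[of k t] by (simp add: w_def s_def coeff_sum N_def)
  qed
  then have w: "row_inner cs (\<lambda>k. P n $$ (i, k)) w = 0"
    using Suc.IH[of w] Suc.prems(1) by (simp add: N_def)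
  have "row_inner cs (\<lambda>k. P n $$ (i, k)) (\<lambda>k. P m $$ (j, k)) = 0" if "j < N" for j
  proof -
    have "weight_inner N (classical_sum cs) (P n) (P m) = 0\<^sub>m N N"
      using P Suc.prems(1) unfolding is_monic_orthogonal_def N_def by auto
    moreover have "P n \<in> carrier_mat N N"
      using P unfolding is_monic_orthogonal_def monic_of_degree_def N_def by auto
    ultimately show ?thesis
      using weight_inner_index[of cs "P n" "P m" i j] adm Pm(1) i that by (simp add: N_def)
  qed
  then have "row_inner cs (\<lambda>k. P n $$ (i, k)) s = 0"
    by (simp add: s_def[abs_def] row_inner_sum_right row_inner_smult_right)
  then have "row_inner cs (\<lambda>k. P n $$ (i, k)) (\<lambda>k. w k + s k) = 0"
    by (simp add: row_inner_add_right w)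
  then show ?case by (simp add: w_def)
qed

text \<open>
  A row of \<open>P n - Q n\<close> has degree below \<open>n\<close>, so it is orthogonal to the corresponding rows of both \<open>P n\<close>
  and \<open>Q n\<close>, hence to itself.
\<close>

lemma monic_orthogonal_unique:
  assumes P: "is_monic_orthogonal (length cs) (classical_sum cs) P"
    and Q: "is_monic_orthogonal (length cs) (classical_sum cs) Q"
  shows "P = Q"
proof
  fix n
  define N where "N = length cs"
  have monic: "monic_of_degree N n (P n)" "monic_of_degree N n (Q n)"
    using P Q by (auto simp: is_monic_orthogonal_def N_def)
  have "P n $$ (i, k) = Q n $$ (i, k)" if ik: "i < N" "k < N" for i k
  proof -
    define r where "r k = P n $$ (i, k) - Q n $$ (i, k)" for k
    have "coeff (r k) t = 0" if "k < length cs" "t \<ge> n" for k t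
    proof (cases "t = n")
      case True
      have "coeff (P n $$ (i, k)) n = (1\<^sub>m N :: complex mat) $$ (i, k)"
        "coeff (Q n $$ (i, k)) n = (1\<^sub>m N :: complex mat) $$ (i, k)"
        using monic that \<open>i < N\<close> unfolding monic_of_degree_def N_def
        by (metis carrier_matD index_map_mat(1))+
      then show ?thesis by (simp add: r_def True)
    next
      case False
      then have "degree (P n $$ (i, k)) < t" "degree (Q n $$ (i, k)) < t"
        using monic that \<open>i < N\<close> unfolding monic_of_degree_def N_def
        by (metis le_less_trans le_neq_implies_less)+
      then show ?thesis by (simp add: r_def coeff_eq_0)
    qed
    then have "row_inner cs (\<lambda>k. P n $$ (i, k)) r = 0" "row_inner cs (\<lambda>k. Q n $$ (i, k)) r = 0"
      using monic_orthogonal_lower[OF P, of i n n r] monic_orthogonal_lower[OF Q, of i n n r] ik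
      by (simp_all add: N_def)
    then have "row_inner cs r r = 0"
      unfolding r_def[abs_def] by (simp add: row_inner_diff_left)
    then show ?thesis using row_inner_definite[of r k] ik by (simp add: r_def N_def)
  qed
  then show "P n = Q n"
    using monic unfolding monic_of_degree_def by (intro eq_matI) auto
qed

lemma monic_orthogonal_classical_sum:
  "monic_orthogonal (length cs) (classical_sum cs) = (\<lambda>n. mat_diag (length cs) (\<lambda>k. eigenpoly (cs ! k) n))"
proof -
  define P where "P n = mat_diag (length cs) (\<lambda>k. eigenpoly (cs ! k) n)" for n
  have P: "P n \<in> carrier_mat (length cs) (length cs)" for n
    by (simp add: P_def mat_diag_def)
  have entry: "P n $$ (i, j) = (if i = j then eigenpoly (cs ! i) n else 0)"
    if "i < length cs" "j < length cs" for i j n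
    using that by (simp add: P_def mat_diag_def)
  have "monic_of_degree (length cs) n (P n)" for n
    unfolding monic_of_degree_def
    using P[of n] by (auto simp: entry degree_eigenpoly adm_nth coeff_eigenpoly intro!: eq_matI)
  moreover have "weight_inner (length cs) (classical_sum cs) (P n) (P k) = 0\<^sub>m (length cs) (length cs)"
    if "n \<noteq> k" for n k
  proof (rule eq_matI)
    fix i j assume "i < dim_row (0\<^sub>m (length cs) (length cs) :: complex mat)"
      "j < dim_col (0\<^sub>m (length cs) (length cs) :: complex mat)"
    then have ij: "i < length cs" "j < length cs" by auto
    have "weight_integral (cs ! l) (P n $$ (i, l) * map_poly cnj (P k $$ (j, l))) = 0" if "l < length cs" for l
      using that ij \<open>n \<noteq> k\<close>
      by (auto simp: entry map_poly_cnj_eigenpoly adm_nth eigenpoly_orthogonal weight_integral_0)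
    then show "weight_inner (length cs) (classical_sum cs) (P n) (P k) $$ (i, j)
        = 0\<^sub>m (length cs) (length cs) $$ (i, j)"
      using ij weight_inner_index[of cs "P n" "P k" i j] adm P by (simp add: row_inner_def)
  qed (simp_all add: weight_inner_def)
  ultimately have "is_monic_orthogonal (length cs) (classical_sum cs) P"
    by (simp add: is_monic_orthogonal_def)
  then have "monic_orthogonal (length cs) (classical_sum cs) = P"
    unfolding monic_orthogonal_def using monic_orthogonal_unique by (intro the_equality) auto
  then show ?thesis by (simp add: P_def[abs_def])
qed

text \<open>
  Since the orthogonal polynomials are diagonal matrices, the condition defining the algebra decouples into
  one intertwining condition per entry.
\<close>

lemma diffop_algebra_classical_sum:
  "D \<in> diffop_algebra (length cs) (classical_sum cs) \<longleftrightarrow>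
     D \<in> carrier_mat (length cs) (length cs) \<and>
     (\<forall>i<length cs. \<forall>j<length cs. intertwines (cs ! i) (cs ! j) (D $$ (i, j)))"
proof (cases "D \<in> carrier_mat (length cs) (length cs)")
  case D: True
  define N where "N = length cs"
  define P where "P n = mat_diag N (\<lambda>k. eigenpoly (cs ! k) n)" for n
  have act: "mat_act (P n) D $$ (i, j) = act (D $$ (i, j)) (eigenpoly (cs ! i) n)" if "i < N" "j < N" for i j n
  proof -
    have "mat_act (P n) D $$ (i, j) = (\<Sum>k<N. act (D $$ (k, j)) (if i = k then eigenpoly (cs ! i) n else 0))"
      using that D by (auto simp: mat_act_def P_def mat_diag_def N_def intro!: sum.cong)
    also have "\<dots> = (\<Sum>k<N. if k = i then act (D $$ (i, j)) (eigenpoly (cs ! i) n) else 0)"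
      by (intro sum.cong) (auto simp: act_0_arg)
    finally show ?thesis using that by simp
  qed
  have mult: "(map_mat (\<lambda>c. [:c:]) \<Lambda> * P n) $$ (i, j) = Polynomial.smult (\<Lambda> $$ (i, j)) (eigenpoly (cs ! j) n)"
    if "i < N" "j < N" "\<Lambda> \<in> carrier_mat N N" for i j n \<Lambda>
    unfolding P_def using that by (subst mat_diag_mult_right[of _ N N]) auto
  have "(\<exists>\<Lambda> \<in> carrier_mat N N. mat_act (P n) D = map_mat (\<lambda>c. [:c:]) \<Lambda> * P n) \<longleftrightarrow>
      (\<forall>i<N. \<forall>j<N. \<exists>a. act (D $$ (i, j)) (eigenpoly (cs ! i) n) = Polynomial.smult a (eigenpoly (cs ! j) n))"
    (is "?L \<longleftrightarrow> ?R") for n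
  proof
    assume ?L
    then obtain \<Lambda> where "\<Lambda> \<in> carrier_mat N N" "mat_act (P n) D = map_mat (\<lambda>c. [:c:]) \<Lambda> * P n" by blast
    then show ?R using act mult by metis
  next
    assume ?R
    then obtain a where a: "\<And>i j. i < N \<Longrightarrow> j < N \<Longrightarrow>
        act (D $$ (i, j)) (eigenpoly (cs ! i) n) = Polynomial.smult (a i j) (eigenpoly (cs ! j) n)" by metis
    define \<Lambda> where "\<Lambda> = Matrix.mat N N (\<lambda>(i, j). a i j)"
    have \<Lambda>: "\<Lambda> \<in> carrier_mat N N" by (simp add: \<Lambda>_def)
    have "mat_act (P n) D = map_mat (\<lambda>c. [:c:]) \<Lambda> * P n"
    proof (rule eq_matI)
      fix i j assume "i < dim_row (map_mat (\<lambda>c. [:c:]) \<Lambda> * P n)" "j < dim_col (map_mat (\<lambda>c. [:c:]) \<Lambda> * P n)"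
      then have "i < N" "j < N" by (auto simp: \<Lambda>_def P_def mat_diag_def)
      then show "mat_act (P n) D $$ (i, j) = (map_mat (\<lambda>c. [:c:]) \<Lambda> * P n) $$ (i, j)"
        by (simp add: act mult \<Lambda> a) (simp add: \<Lambda>_def)
    qed (use D in \<open>auto simp: mat_act_def P_def \<Lambda>_def mat_diag_def N_def\<close>)
    then show ?L using \<Lambda> by blast
  qed
  then show ?thesis
    unfolding diffop_algebra_def monic_orthogonal_classical_sum intertwines_def
    using D by (auto simp: P_def N_def)
qed (simp add: diffop_algebra_def)

end

section \<open>Darboux equivalence of classical weights and the center\<close>

lemma intertwines_0: "intertwines c d 0"
  unfolding intertwines_def by (auto simp: act_simps intro: exI[of _ 0])

lemma intertwines_op_poly: "admissible c \<Longrightarrow> intertwines c c (op_poly p (classical_op c))"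
  unfolding intertwines_def by (auto simp: act_op_poly_eigenpoly)

lemma darboux_map_nonzero: "darboux_map c d V \<Longrightarrow> V \<noteq> 0"
  unfolding darboux_map_def degree_preserving_def by (metis zero_diffop.rep_eq zero_neq_one)

lemma scalar_matrix_classical: "scalar_matrix (weight c) = classical_sum [c]"
  by (intro ext eq_matI) (auto simp: classical_sum_diag scalar_matrix_def mat_diag_def)

lemma scalar_orthogonal_classical:
  assumes "admissible c"
  shows "scalar_orthogonal (weight c) n = eigenpoly c n"
  using monic_orthogonal_classical_sum[of "[c]"] assms
  by (simp add: scalar_orthogonal_def scalar_matrix_classical mat_diag_def)

lemma scalar_diffop_algebra_classical:
  assumes "admissible c"
  shows "D \<in> scalar_diffop_algebra (weight c) \<longleftrightarrow> intertwines c c D"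
  using diffop_algebra_classical_sum[of "[c]" "Matrix.mat 1 1 (\<lambda>_. D)"] assms
  by (simp add: scalar_diffop_algebra_def scalar_matrix_classical)

lemma weight_support_same_type:
  assumes "same_type {c, d}"
  shows "weight_support (weight c) = weight_support (weight d)"
proof -
  have "weight c x \<noteq> 0 \<longleftrightarrow> weight d x \<noteq> 0" for x
    using assms by (cases rule: same_type_pair_cases) auto
  then show ?thesis by (simp add: weight_support_def)
qed

text \<open>
  A Darboux transformation contains a nonzero intertwiner, whose existence forces an integer shift.
  Conversely, ladder operators go both ways, and the composition of the two directions is an operator in
  the algebra of \<open>c\<close> that factors as required.
\<close>

lemma darboux_iff_integer_shift:
  assumes c: "admissible c" and d: "admissible d" and st: "same_type {c, d}"
  shows "darboux (weight c) (weight d) \<longleftrightarrow> integer_shift c d"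
proof
  assume "darboux (weight c) (weight d)"
  then obtain V where "degree_preserving V" "\<forall>n. \<exists>a. act V (eigenpoly c n) = Polynomial.smult a (eigenpoly d n)"
    unfolding darboux_def scalar_orthogonal_classical[OF c] scalar_orthogonal_classical[OF d] by blast
  then have "darboux_map c d V" by (simp add: darboux_map_def intertwines_def)
  then show "integer_shift c d"
    using intertwiner_integer_shift[OF c d st] darboux_map_nonzero by (auto simp: darboux_map_def)
next
  assume "integer_shift c d"
  then obtain V N where V: "darboux_map c d V" and N: "darboux_map d c N"
    using integer_shift_imp_darboux_maps[OF c d] by (auto simp: darboux_maps_both_def)
  have "V * N \<in> scalar_diffop_algebra (weight c)"
    using darboux_map_mult[OF V N] by (simp add: scalar_diffop_algebra_classical[OF c] darboux_map_def)
  then show "darboux (weight c) (weight d)"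
    unfolding darboux_def scalar_orthogonal_classical[OF c] scalar_orthogonal_classical[OF d]
    using V N weight_support_same_type[OF st]
    by (auto simp: darboux_map_def intertwines_def)
qed

definition matrix_unit :: "nat \<Rightarrow> nat \<Rightarrow> nat \<Rightarrow> diffop \<Rightarrow> diffop mat" where
  "matrix_unit N r s V = Matrix.mat N N (\<lambda>(i, j). if i = r \<and> j = s then V else 0)"

lemma matrix_unit_mult_right:
  assumes "D \<in> carrier_mat N N" "i < N" "j < N" "r < N"
  shows "(D * matrix_unit N r s V) $$ (i, j) = (if j = s then D $$ (i, r) * V else 0)"
proof -
  have "(D * matrix_unit N r s V) $$ (i, j) = (\<Sum>k = 0..<N. D $$ (i, k) * (if k = r \<and> j = s then V else 0))"
    using assms by (simp add: matrix_unit_def scalar_prod_def)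
  also have "\<dots> = (\<Sum>k = 0..<N. if k = r then (if j = s then D $$ (i, r) * V else 0) else 0)"
    by (intro sum.cong) auto
  finally show ?thesis using assms by simp
qed

lemma matrix_unit_mult_left:
  assumes "D \<in> carrier_mat N N" "i < N" "j < N" "s < N"
  shows "(matrix_unit N r s V * D) $$ (i, j) = (if i = r then V * D $$ (s, j) else 0)"
proof -
  have "(matrix_unit N r s V * D) $$ (i, j) = (\<Sum>k = 0..<N. (if i = r \<and> k = s then V else 0) * D $$ (k, j))"
    using assms by (simp add: matrix_unit_def scalar_prod_def)
  also have "\<dots> = (\<Sum>k = 0..<N. if k = s then (if i = r then V * D $$ (s, j) else 0) else 0)"
    by (intro sum.cong) auto
  finally show ?thesis using assms by simp
qed

lemma same_type_subset: "same_type C \<Longrightarrow> B \<subseteq> C \<Longrightarrow> same_type B"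
  unfolding same_type_def by blast

text \<open>
  Both sides multiply the image of \<open>p\<^sub>n\<close> by \<open>p\<close> at its eigenvalue, and the eigenvalues for \<open>c\<close> and \<open>d\<close> agree
  as soon as the intertwiner is nonzero.
\<close>

lemma intertwiner_op_poly:
  assumes c: "admissible c" and d: "admissible d" and st: "same_type {c, d}"
    and D: "intertwines c d D"
  shows "op_poly p (classical_op c) * D = D * op_poly p (classical_op d)"
proof (cases "D = 0")
  case False
  show ?thesis
  proof (rule diffop_eqI[OF c])
    fix n
    obtain a where "act D (eigenpoly c n) = Polynomial.smult a (eigenpoly d n)"
      using D unfolding intertwines_def by blast
    then show "act (op_poly p (classical_op c) * D) (eigenpoly c n) =
        act (D * op_poly p (classical_op d)) (eigenpoly c n)"
      using intertwiner_eigval[OF c d st D False]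
      by (simp add: act_simps act_op_poly_eigenpoly c d act_smult_arg mult.commute)
  qed
qed simp

text \<open>
  A degree-preserving intertwiner kills no \<open>p\<^sub>n\<close>, so the commutation relation makes \<open>p\<close> and \<open>q\<close> agree at all
  of the infinitely many eigenvalues.
\<close>

lemma op_poly_eq_of_darboux_map:
  assumes c: "admissible c" and d: "admissible d" and st: "same_type {c, d}"
    and V: "darboux_map c d V"
    and comm: "op_poly p (classical_op c) * V = V * op_poly q (classical_op d)"
  shows "p = q"
proof (rule ccontr)
  assume "p \<noteq> q"
  have V': "intertwines c d V" "degree_preserving V" using V by (simp_all add: darboux_map_def)
  have "poly (p - q) (eigval c n) = 0" for n
  proof -
    obtain a where a: "act V (eigenpoly c n) = Polynomial.smult a (eigenpoly d n)"
      using V'(1) unfolding intertwines_def by blast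
    have "a \<noteq> 0"
      using V'(2) a eigenpoly_nonzero[OF c, of n] unfolding degree_preserving_def by fastforce
    have "Polynomial.smult (poly p (eigval c n) * a) (eigenpoly d n) = Polynomial.smult (poly q (eigval d n) * a) (eigenpoly d n)"
      using arg_cong[OF comm, of "\<lambda>E. act E (eigenpoly c n)"]
      by (simp add: act_simps act_op_poly_eigenpoly c d act_smult_arg a mult.commute)
    then have "poly p (eigval c n) * a = poly q (eigval d n) * a"
      using arg_cong[of _ _ "\<lambda>f. coeff f n"] coeff_eigenpoly[OF d, of n] by (metis coeff_smult mult.right_neutral)
    then show ?thesis
      using \<open>a \<noteq> 0\<close> intertwiner_eigval[OF c d st V'(1) darboux_map_nonzero[OF V]] by simp
  qed
  then have "range (eigval c) \<subseteq> {x. poly (p - q) x = 0}" by auto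
  moreover have "finite {x. poly (p - q) x = 0}" using \<open>p \<noteq> q\<close> by (intro poly_roots_finite) simp
  moreover have "infinite (range (eigval c))"
    using eigval_inj[OF c] by (intro range_inj_infinite injI)
  ultimately show False using finite_subset by blast
qed

text \<open>
  A central element commutes with the diagonal matrix units, so it is diagonal, and its entries are polynomials
  in the classical operators by the scalar case. Commuting with a ladder operator placed in the entry
  \<open>(i, j)\<close> identifies the \<open>i\<close>-th and \<open>j\<close>-th of these polynomials. Where there is no integer shift, the
  algebra has no nonzero entries, and no further condition arises.
\<close>

lemma diffop_center_classical_sum:
  assumes adm: "\<And>c. c \<in> set cs \<Longrightarrow> admissible c" and st: "same_type (set cs)"
  shows "diffop_center (length cs) (classical_sum cs) =
    {mat_diag (length cs) (\<lambda>i. op_poly (q i) (classical_op (cs ! i))) | q.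
       \<forall>i<length cs. \<forall>j<length cs. integer_shift (cs ! i) (cs ! j) \<longrightarrow> q i = q j}" (is "_ = ?R")
proof -
  define N where "N = length cs"
  have alg: "D \<in> diffop_algebra N (classical_sum cs) \<longleftrightarrow> D \<in> carrier_mat N N \<and>
     (\<forall>i<N. \<forall>j<N. intertwines (cs ! i) (cs ! j) (D $$ (i, j)))" for D
    unfolding N_def using diffop_algebra_classical_sum[of cs] adm by blast
  have adm': "admissible (cs ! i)" if "i < N" for i using that adm by (simp add: N_def)
  have st': "same_type {cs ! i, cs ! j}" if "i < N" "j < N" for i j
    using that by (intro same_type_subset[OF st]) (auto simp: N_def)
  have unit: "matrix_unit N r s V \<in> diffop_algebra N (classical_sum cs)"
    if "intertwines (cs ! r) (cs ! s) V" for r s V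
    unfolding alg using that by (auto simp: matrix_unit_def intertwines_0)
  show ?thesis
  proof (intro equalityI subsetI)
    fix D assume "D \<in> diffop_center (length cs) (classical_sum cs)"
    then have D: "D \<in> diffop_algebra N (classical_sum cs)"
      and comm: "\<And>E. E \<in> diffop_algebra N (classical_sum cs) \<Longrightarrow> D * E = E * D"
      by (auto simp: diffop_center_def N_def)
    have carr: "D \<in> carrier_mat N N" using D alg by blast
    have off: "D $$ (i, j) = 0" if "i < N" "j < N" "i \<noteq> j" for i j
    proof -
      have "D * matrix_unit N j j 1 = matrix_unit N j j 1 * D"
        using comm[OF unit] darboux_map_one[of "cs ! j"] by (simp add: darboux_map_def)
      from arg_cong[OF this, of "\<lambda>A. A $$ (i, j)"] show ?thesis
        using that carr by (simp add: matrix_unit_mult_right matrix_unit_mult_left)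
    qed
    have "\<exists>p. D $$ (i, i) = op_poly p (classical_op (cs ! i))" if "i < N" for i
      using commutant_classical_op[OF adm'[OF that]] D that alg by blast
    then obtain q where q: "\<And>i. i < N \<Longrightarrow> D $$ (i, i) = op_poly (q i) (classical_op (cs ! i))"
      by metis
    have "q i = q j" if ij: "i < N" "j < N" "integer_shift (cs ! i) (cs ! j)" for i j
    proof -
      obtain V where V: "darboux_map (cs ! i) (cs ! j) V"
        using integer_shift_imp_darboux_maps[OF adm' adm' ij(3)] ij by (auto simp: darboux_maps_both_def)
      then have "D * matrix_unit N i j V = matrix_unit N i j V * D"
        using comm[OF unit] by (simp add: darboux_map_def)
      from arg_cong[OF this, of "\<lambda>A. A $$ (i, j)"]
      have "op_poly (q i) (classical_op (cs ! i)) * V = V * op_poly (q j) (classical_op (cs ! j))"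
        using ij carr by (simp add: matrix_unit_mult_right matrix_unit_mult_left q)
      then show ?thesis
        using op_poly_eq_of_darboux_map[OF adm' adm' st' V] ij by blast
    qed
    moreover have "D = mat_diag N (\<lambda>i. op_poly (q i) (classical_op (cs ! i)))"
      using carr by (intro eq_matI) (auto simp: mat_diag_def off q)
    ultimately show "D \<in> ?R" unfolding N_def by blast
  next
    fix D assume "D \<in> ?R"
    then obtain q where D: "D = mat_diag N (\<lambda>i. op_poly (q i) (classical_op (cs ! i)))"
      and q: "\<And>i j. i < N \<Longrightarrow> j < N \<Longrightarrow> integer_shift (cs ! i) (cs ! j) \<Longrightarrow> q i = q j"
      unfolding N_def by blast
    have "D \<in> diffop_algebra N (classical_sum cs)"
      unfolding alg D by (auto simp: mat_diag_def intertwines_0 intertwines_op_poly adm')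
    moreover have "D * E = E * D" if "E \<in> diffop_algebra N (classical_sum cs)" for E
    proof -
      have E: "E \<in> carrier_mat N N" "\<And>i j. i < N \<Longrightarrow> j < N \<Longrightarrow> intertwines (cs ! i) (cs ! j) (E $$ (i, j))"
        using that unfolding alg by auto
      have "op_poly (q i) (classical_op (cs ! i)) * E $$ (i, j) = E $$ (i, j) * op_poly (q j) (classical_op (cs ! j))"
        if ij: "i < N" "j < N" for i j
      proof (cases "E $$ (i, j) = 0")
        case False
        then have "q i = q j"
          using intertwiner_integer_shift[OF adm' adm' st' E(2)] q ij by blast
        then show ?thesis using intertwiner_op_poly[OF adm' adm' st' E(2)] ij by simp
      qed simp
      then show ?thesis
        unfolding D mat_diag_mult_left[OF E(1)] mat_diag_mult_right[OF E(1)]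
        by (intro eq_matI) auto
    qed
    ultimately show "D \<in> diffop_center (length cs) (classical_sum cs)"
      by (simp add: diffop_center_def N_def)
  qed
qed

lemma mat_diag_power: "mat_diag n f ^\<^sub>m k = mat_diag n (\<lambda>i. f i ^ k)"
  by (induction k) (simp_all add: power_commutes, simp add: mat_diag_def)

lemma poly_op_classical_diag_op:
  "poly_op p (classical_diag_op cs) = mat_diag (length cs) (\<lambda>i. op_poly p (classical_op (cs ! i)))"
  unfolding poly_op_def classical_diag_op_def mat_diag_power
  by (intro eq_matI) (auto simp: mat_diag_def op_poly_def)

lemma diffop_center_equivalent:
  assumes "cs \<noteq> []" "\<And>c. c \<in> set cs \<Longrightarrow> admissible c" "same_type (set cs)"
    and shift: "\<And>i j. i < length cs \<Longrightarrow> j < length cs \<Longrightarrow> integer_shift (cs ! i) (cs ! j)"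
  shows "diffop_center (length cs) (classical_sum cs) = poly_algebra (classical_diag_op cs)"
proof -
  have "diffop_center (length cs) (classical_sum cs) =
    {mat_diag (length cs) (\<lambda>i. op_poly (q i) (classical_op (cs ! i))) | q.
       \<forall>i<length cs. \<forall>j<length cs. integer_shift (cs ! i) (cs ! j) \<longrightarrow> q i = q j}"
    using assms(2,3) by (rule diffop_center_classical_sum)
  also have "\<dots> = poly_algebra (classical_diag_op cs)"
    unfolding poly_algebra_def
  proof (intro equalityI subsetI)
    fix D assume "D \<in> {mat_diag (length cs) (\<lambda>i. op_poly (q i) (classical_op (cs ! i))) | q.
         \<forall>i<length cs. \<forall>j<length cs. integer_shift (cs ! i) (cs ! j) \<longrightarrow> q i = q j}"
    then obtain q where D: "D = mat_diag (length cs) (\<lambda>i. op_poly (q i) (classical_op (cs ! i)))"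
      and q: "\<And>i j. i < length cs \<Longrightarrow> j < length cs \<Longrightarrow> q i = q j" using shift by blast
    have "q i = q 0" if "i < length cs" for i using q that assms(1) by blast
    then have "D = poly_op (q 0) (classical_diag_op cs)"
      unfolding D poly_op_classical_diag_op by (intro eq_matI) (auto simp: mat_diag_def)
    then show "D \<in> range (\<lambda>p. poly_op p (classical_diag_op cs))" by blast
  qed (auto simp: poly_op_classical_diag_op)
  finally show ?thesis .
qed

lemma in_listset_iff: "xs \<in> listset As \<longleftrightarrow> list_all2 (\<in>) xs As"
  by (induction As arbitrary: xs) (auto simp: set_Cons_def list_all2_Cons2)

text \<open>
  Tagging each weight with the number of its block turns the block sum into a single diagonal matrix whose
  \<open>i\<close>-th polynomial depends only on the tag of \<open>i\<close>, which is the shape of the description of the center.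
\<close>

lemma block_direct_sum_poly_algebras:
  fixes css :: "classical list list"
  defines "tagged \<equiv> concat (map (\<lambda>b. map (Pair b) (css ! b)) [0..<length css])"
  shows "block_direct_sum (map (\<lambda>cs. poly_algebra (classical_diag_op cs)) css) =
    range (\<lambda>q. mat_diag (length tagged) (\<lambda>i. op_poly (q (fst (tagged ! i))) (classical_op (snd (tagged ! i)))))"
proof -
  define M where "M q b = poly_op (q b) (classical_diag_op (css ! b))" for q b
  have "listset (map (\<lambda>cs. poly_algebra (classical_diag_op cs)) css) = range (\<lambda>q. map (M q) [0..<length css])"
  proof (intro equalityI subsetI)
    fix Ds assume "Ds \<in> listset (map (\<lambda>cs. poly_algebra (classical_diag_op cs)) css)"
    then have Ds: "length Ds = length css" "\<And>b. b < length css \<Longrightarrow> \<exists>p. Ds ! b = poly_op p (classical_diag_op (css ! b))"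
      by (fastforce simp: in_listset_iff list_all2_conv_all_nth poly_algebra_def)+
    then obtain q where "\<And>b. b < length css \<Longrightarrow> Ds ! b = poly_op (q b) (classical_diag_op (css ! b))" by metis
    then have "Ds = map (M q) [0..<length css]"
      using Ds(1) by (intro nth_equalityI) (simp_all add: M_def)
    then show "Ds \<in> range (\<lambda>q. map (M q) [0..<length css])" by blast
  qed (auto simp: in_listset_iff list_all2_conv_all_nth poly_algebra_def M_def)
  moreover have "diag_block_mat (map (M q) [0..<length css]) =
      mat_diag (length tagged) (\<lambda>i. op_poly (q (fst (tagged ! i))) (classical_op (snd (tagged ! i))))" for q
  proof -
    define g where "g x = op_poly (q (fst x)) (classical_op (snd x))" for x :: "nat \<times> classical"
    have "M q b = mat_diag (length (map (Pair b) (css ! b))) (\<lambda>j. g (map (Pair b) (css ! b) ! j))" for b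
      unfolding M_def poly_op_classical_diag_op by (intro eq_matI) (auto simp: mat_diag_def g_def)
    then have "map (M q) [0..<length css] = map (\<lambda>xs. mat_diag (length xs) (\<lambda>j. g (xs ! j)))
        (map (\<lambda>b. map (Pair b) (css ! b)) [0..<length css])"
      by simp
    then show ?thesis
      unfolding tagged_def using diag_block_mat_diags[of g "map (\<lambda>b. map (Pair b) (css ! b)) [0..<length css]"]
      by (simp only: g_def)
  qed
  ultimately show ?thesis by (simp add: block_direct_sum_def image_image)
qed

theorem theorem6p6:
  fixes css :: "classical list list"
  assumes "css \<noteq> []"
    and "\<And>i. i < length css \<Longrightarrow> css ! i \<noteq> []"
    and "\<And>c. c \<in> set (concat css) \<Longrightarrow> admissible c"
    and "same_type (set (concat css))"
    and "\<And>i j l. i < length css \<Longrightarrow> j < length (css ! i) \<Longrightarrow> l < length (css ! i) \<Longrightarrow>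
           darboux (weight (css ! i ! j)) (weight (css ! i ! l))"
    and "\<And>i r j l. i < length css \<Longrightarrow> r < length css \<Longrightarrow> i \<noteq> r \<Longrightarrow>
           l < length (css ! i) \<Longrightarrow> j < length (css ! r) \<Longrightarrow>
           \<not> darboux (weight (css ! i ! l)) (weight (css ! r ! j))"
  shows "diffop_center (sum_list (map length css)) (direct_sum (map classical_sum css))
           = block_direct_sum (map (\<lambda>cs. diffop_center (length cs) (classical_sum cs)) css)
       \<and> block_direct_sum (map (\<lambda>cs. diffop_center (length cs) (classical_sum cs)) css)
           = block_direct_sum (map (\<lambda>cs. poly_algebra (classical_diag_op cs)) css)"
proof -
  note adm = assms(3) and st = assms(4)
  have mem: "css ! b ! j \<in> set (concat css)" if "b < length css" "j < length (css ! b)" for b j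
    using that by (auto intro!: bexI[of _ "css ! b"])
  have shift: "darboux (weight c) (weight d) \<longleftrightarrow> integer_shift c d"
    if "c \<in> set (concat css)" "d \<in> set (concat css)" for c d
    using that by (intro darboux_iff_integer_shift adm same_type_subset[OF st]) auto
  have blocks: "diffop_center (length cs) (classical_sum cs) = poly_algebra (classical_diag_op cs)"
    if cs: "cs \<in> set css" for cs
  proof -
    obtain b where b: "b < length css" "cs = css ! b" using cs by (auto simp: in_set_conv_nth)
    have sub: "set cs \<subseteq> set (concat css)" using cs by auto
    show ?thesis
    proof (rule diffop_center_equivalent)
      show "cs \<noteq> []" using assms(2) b by simp
      show "admissible c" if "c \<in> set cs" for c using adm sub that by blast
      show "same_type (set cs)" using same_type_subset[OF st sub] .
      show "integer_shift (cs ! i) (cs ! j)" if "i < length cs" "j < length cs" for i j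
        using assms(5) shift[OF mem mem] b that by blast
    qed
  qed
  define tagged where "tagged = concat (map (\<lambda>b. map (Pair b) (css ! b)) [0..<length css])"
  define N where "N = length (concat css)"
  have snd_tagged: "map snd tagged = concat css"
    by (simp add: tagged_def map_concat comp_def map_nth)
  have len: "length tagged = N" using arg_cong[OF snd_tagged, of length] by (simp add: N_def)
  have nth_snd: "snd (tagged ! i) = concat css ! i" if "i < N" for i
    using that len snd_tagged by (metis nth_map)
  have tag: "\<exists>j. fst (tagged ! i) < length css \<and> j < length (css ! fst (tagged ! i)) \<and>
      concat css ! i = css ! fst (tagged ! i) ! j" if "i < N" for i
  proof -
    have "tagged ! i \<in> set tagged" using that len by simp
    then have "fst (tagged ! i) < length css" "snd (tagged ! i) \<in> set (css ! fst (tagged ! i))"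
      by (auto simp: tagged_def)
    then show ?thesis using nth_snd[OF that] by (metis in_set_conv_nth)
  qed
  \<comment> \<open>Here both hypotheses on Darboux equivalence enter: within blocks and across them.\<close>
  have same_tag: "integer_shift (concat css ! i) (concat css ! j) \<longleftrightarrow> fst (tagged ! i) = fst (tagged ! j)"
    if ij: "i < N" "j < N" for i j
  proof -
    define a b where "a = fst (tagged ! i)" and "b = fst (tagged ! j)"
    obtain k where k: "a < length css" "k < length (css ! a)" "concat css ! i = css ! a ! k"
      using tag[OF ij(1)] by (auto simp: a_def)
    obtain l where l: "b < length css" "l < length (css ! b)" "concat css ! j = css ! b ! l"
      using tag[OF ij(2)] by (auto simp: b_def)
    have "integer_shift (css ! a ! k) (css ! b ! l) \<longleftrightarrow> a = b"
      using assms(5)[of a k l] assms(6)[of a b k l] k l shift[OF mem mem, of a k b l] by blast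
    then show ?thesis using k l by (simp add: a_def b_def)
  qed
  have "diffop_center N (classical_sum (concat css)) =
      {mat_diag N (\<lambda>i. op_poly (q i) (classical_op (concat css ! i))) | q.
       \<forall>i<N. \<forall>j<N. fst (tagged ! i) = fst (tagged ! j) \<longrightarrow> q i = q j}"
  proof -
    have "(\<forall>i<N. \<forall>j<N. fst (tagged ! i) = fst (tagged ! j) \<longrightarrow> q i = q j) \<longleftrightarrow>
      (\<forall>i<N. \<forall>j<N. integer_shift (concat css ! i) (concat css ! j) \<longrightarrow> q i = q j)" for q :: "nat \<Rightarrow> complex poly"
      using same_tag by blast
    then show ?thesis
      unfolding N_def using diffop_center_classical_sum[of "concat css"] adm st by simp
  qed
  also have "\<dots> = range (\<lambda>q. mat_diag N (\<lambda>i. op_poly (q (fst (tagged ! i))) (classical_op (snd (tagged ! i)))))"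
  proof (intro equalityI subsetI)
    fix D assume "D \<in> {mat_diag N (\<lambda>i. op_poly (q i) (classical_op (concat css ! i))) | q.
       \<forall>i<N. \<forall>j<N. fst (tagged ! i) = fst (tagged ! j) \<longrightarrow> q i = q j}"
    then obtain q where D: "D = mat_diag N (\<lambda>i. op_poly (q i) (classical_op (concat css ! i)))"
      and q: "\<And>i j. i < N \<Longrightarrow> j < N \<Longrightarrow> fst (tagged ! i) = fst (tagged ! j) \<Longrightarrow> q i = q j" by blast
    \<comment> \<open>The polynomial of a block is the one at an arbitrary position carrying its tag.\<close>
    define q' where "q' b = q (SOME i. i < N \<and> fst (tagged ! i) = b)" for b
    have "q' (fst (tagged ! i)) = q i" if "i < N" for i
    proof -
      have "\<exists>k. k < N \<and> fst (tagged ! k) = fst (tagged ! i)" using that by blast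
      from someI_ex[OF this] show ?thesis using q that unfolding q'_def by blast
    qed
    then have "D = mat_diag N (\<lambda>i. op_poly (q' (fst (tagged ! i))) (classical_op (snd (tagged ! i))))"
      unfolding D by (intro eq_matI) (auto simp: mat_diag_def nth_snd)
    then show "D \<in> range (\<lambda>q. mat_diag N (\<lambda>i. op_poly (q (fst (tagged ! i))) (classical_op (snd (tagged ! i)))))"
      by blast
  next
    fix D assume "D \<in> range (\<lambda>q. mat_diag N (\<lambda>i. op_poly (q (fst (tagged ! i))) (classical_op (snd (tagged ! i)))))"
    then obtain q where "D = mat_diag N (\<lambda>i. op_poly (q (fst (tagged ! i))) (classical_op (snd (tagged ! i))))" by blast
    then have "D = mat_diag N (\<lambda>i. op_poly ((\<lambda>i. q (fst (tagged ! i))) i) (classical_op (concat css ! i)))"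
      by (simp only:, intro eq_matI) (auto simp: mat_diag_def nth_snd)
    then show "D \<in> {mat_diag N (\<lambda>i. op_poly (q i) (classical_op (concat css ! i))) | q.
       \<forall>i<N. \<forall>j<N. fst (tagged ! i) = fst (tagged ! j) \<longrightarrow> q i = q j}"
      by (intro CollectI exI[of _ "\<lambda>i. q (fst (tagged ! i))"]) simp
  qed
  also have "\<dots> = block_direct_sum (map (\<lambda>cs. poly_algebra (classical_diag_op cs)) css)"
    unfolding block_direct_sum_poly_algebras tagged_def[symmetric] len ..
  finally have "diffop_center (sum_list (map length css)) (direct_sum (map classical_sum css)) =
      block_direct_sum (map (\<lambda>cs. poly_algebra (classical_diag_op cs)) css)"
    by (simp add: N_def length_concat direct_sum_classical_sums)
  moreover have "map (\<lambda>cs. diffop_center (length cs) (classical_sum cs)) css =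
      map (\<lambda>cs. poly_algebra (classical_diag_op cs)) css"
    using blocks by (intro map_cong refl)
  ultimately show ?thesis by (simp only:)
qed

end
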